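(* Let $n\ge1$ be an integer, $p$ an odd integer, $\mu=\mu_{1/(2n)}$, and suppose that both $E(\Gamma)=\{e_\gamma:\gamma\in\Gamma\}$ and $E(p\Gamma)=\{e_{p\gamma}:\gamma\in\Gamma\}$ are orthonormal bases of $L^2(\mu)$. Let $U$ be the unitary operator on $L^2(\mu)$ determined by $Ue_\gamma=e_{p\gamma}$, $\gamma\in\Gamma$. Then the matrix of $U$ with respect to $E(\Gamma)$, with $\Gamma$ ordered by the partition $\{0\},\Gamma_0,\Gamma_1,\Gamma_2,\dots$, is block diagonal: the $(0,0)$ entry is $1$, all off-diagonal blocks are zero, and for every $k\ge0$ the $(\Gamma_k,\Gamma_k)$ block equals the matrix of $U|_{W_0}$ (when $\Gamma_k$ is identified with $\Gamma_0$ via $(2n)^k(\frac n2+2n\gamma)\leftrightarrow\frac n2+2n\gamma$, $\gamma\in\Gamma$). In other words, $U$ is unitarily equivalent to $$P_{e_0}\oplus\bigoplus_{k=0}^\infty U|_{W_0},$$ where $P_{e_0}$ is the orthogonal projection onto $\mathrm{sp}\{e_0\}$ (acting on the one-dimensional summand $\mathrm{sp}\{e_0\}$).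
   Context: For $\lambda\in(0,1)$, $\mu_\lambda$ is the unique Borel probability measure on $\mathbb{R}$ satisfying $\mu_\lambda=\frac12\mu_\lambda\circ\tau_+^{-1}+\frac12\mu_\lambda\circ\tau_-^{-1}$, where $\tau_\pm(x)=\lambda(x\pm1)$. For $t\in\mathbb{R}$, $e_t(x)=e^{2\pi i t x}$ in $L^2(\mu)$. $\Gamma=\{\sum_{i=0}^m a_i(2n)^i: m\ge0,\ a_i\in\{0,\frac n2\}\}$. For $k\ge0$, $\Gamma_k=(2n)^k\Gamma\setminus(2n)^{k+1}\Gamma=(2n)^k(\frac n2+2n\Gamma)$; the sets $\Gamma_k$ partition $\Gamma\setminus\{0\}$. $S_0,S_1$ are the isometries of $L^2(\mu)$ determined by $S_0e_\gamma=e_{2n\gamma}$, $S_1e_\gamma=e_{\frac n2+2n\gamma}$ ($\gamma\in\Gamma$), and $W_k=S_0^kS_1(L^2(\mu))$, which is the closed span of $E(\Gamma_k)=\{e_\gamma:\gamma\in\Gamma_k\}$. Each $W_k$ is invariant under $U$, so $U|_{W_k}$ is an operator on $W_k$. The $(\xi,\gamma)$ matrix entry of $U$ is $\langle e_\xi,Ue_\gamma\rangle=\widehat\mu(p\gamma-\xi)$, where $\widehat\mu(t)=\int e^{2\pi i x t}\,d\mu(x)$ (a real, even function). *)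

theory Defs
  imports "HOL-Probability.Probability"
begin

section \<open>Complex inner product spaces with explicit carrier\<close>

text \<open>
  The space $L^2(\mu)$ depends on the measure, so it is not a type; we use carrier sets.
  The inner product is conjugate linear in the first argument and linear in the second.
\<close>

record 'v inner_space =
  vecs :: "'v set"
  vzero :: 'v
  vadd :: "'v \<Rightarrow> 'v \<Rightarrow> 'v"
  vscale :: "complex \<Rightarrow> 'v \<Rightarrow> 'v"
  vinner :: "'v \<Rightarrow> 'v \<Rightarrow> complex"

definition vdiff :: "'v inner_space \<Rightarrow> 'v \<Rightarrow> 'v \<Rightarrow> 'v" where
  "vdiff H x y = vadd H x (vscale H (-1) y)"

definition vnorm :: "'v inner_space \<Rightarrow> 'v \<Rightarrow> real" where
  "vnorm H x = sqrt (Re (vinner H x x))"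

definition subsp :: "'v inner_space \<Rightarrow> 'v set \<Rightarrow> 'v inner_space" where
  "subsp H W = H\<lparr>vecs := W\<rparr>"

inductive_set vspan :: "'v inner_space \<Rightarrow> 'v set \<Rightarrow> 'v set"
  for H :: "'v inner_space" and B :: "'v set" where
  zero: "vzero H \<in> vspan H B"
| base: "x \<in> B \<Longrightarrow> x \<in> vspan H B"
| add: "x \<in> vspan H B \<Longrightarrow> y \<in> vspan H B \<Longrightarrow> vadd H x y \<in> vspan H B"
| scale: "x \<in> vspan H B \<Longrightarrow> vscale H c x \<in> vspan H B"

definition vclosure :: "'v inner_space \<Rightarrow> 'v set \<Rightarrow> 'v set" where
  "vclosure H A = {x \<in> vecs H. \<forall>\<epsilon>>0. \<exists>y\<in>A. vnorm H (vdiff H x y) < \<epsilon>}"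

definition orthonormal_basis :: "'v inner_space \<Rightarrow> 'v set \<Rightarrow> bool" where
  "orthonormal_basis H B \<longleftrightarrow>
     B \<subseteq> vecs H \<and>
     (\<forall>x\<in>B. \<forall>y\<in>B. vinner H x y = (if x = y then 1 else 0)) \<and>
     vclosure H (vspan H B) = vecs H"

definition linear_op :: "'v inner_space \<Rightarrow> 'w inner_space \<Rightarrow> ('v \<Rightarrow> 'w) \<Rightarrow> bool" where
  "linear_op H K T \<longleftrightarrow>
     T \<in> vecs H \<rightarrow> vecs K \<and>
     (\<forall>x\<in>vecs H. \<forall>y\<in>vecs H. T (vadd H x y) = vadd K (T x) (T y)) \<and>
     (\<forall>c. \<forall>x\<in>vecs H. T (vscale H c x) = vscale K c (T x))"

definition isometry_op :: "'v inner_space \<Rightarrow> 'w inner_space \<Rightarrow> ('v \<Rightarrow> 'w) \<Rightarrow> bool" where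
  "isometry_op H K T \<longleftrightarrow> linear_op H K T \<and> (\<forall>x\<in>vecs H. vnorm K (T x) = vnorm H x)"

definition unitary_op :: "'v inner_space \<Rightarrow> 'w inner_space \<Rightarrow> ('v \<Rightarrow> 'w) \<Rightarrow> bool" where
  "unitary_op H K T \<longleftrightarrow> isometry_op H K T \<and> T ` vecs H = vecs K"

definition unitarily_equivalent ::
  "'v inner_space \<Rightarrow> ('v \<Rightarrow> 'v) \<Rightarrow> 'w inner_space \<Rightarrow> ('w \<Rightarrow> 'w) \<Rightarrow> bool" where
  "unitarily_equivalent H T K S \<longleftrightarrow>
     linear_op H H T \<and> linear_op K K S \<and>
     (\<exists>V. unitary_op H K V \<and> (\<forall>x\<in>vecs H. V (T x) = S (V x)))"

definition op_matrix ::
  "'v inner_space \<Rightarrow> ('i \<Rightarrow> 'v) \<Rightarrow> ('v \<Rightarrow> 'v) \<Rightarrow> 'i \<Rightarrow> 'i \<Rightarrow> complex" where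
  "op_matrix H b T \<xi> \<gamma> = vinner H (b \<xi>) (T (b \<gamma>))"

definition orth_proj :: "'v inner_space \<Rightarrow> 'v set \<Rightarrow> 'v \<Rightarrow> 'v" where
  "orth_proj H W x = (THE y. y \<in> W \<and> (\<forall>w\<in>W. vinner H w (vdiff H x y) = 0))"

definition hilbert_sum :: "(nat \<Rightarrow> 'v inner_space) \<Rightarrow> (nat \<Rightarrow> 'v) inner_space" where
  "hilbert_sum H =
     \<lparr>vecs = {h. (\<forall>i. h i \<in> vecs (H i)) \<and> summable (\<lambda>i. (vnorm (H i) (h i))\<^sup>2)},
      vzero = (\<lambda>i. vzero (H i)),
      vadd = (\<lambda>g h i. vadd (H i) (g i) (h i)),
      vscale = (\<lambda>c h i. vscale (H i) c (h i)),
      vinner = (\<lambda>g h. \<Sum>i. vinner (H i) (g i) (h i))\<rparr>"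

definition sum_op :: "(nat \<Rightarrow> 'v \<Rightarrow> 'v) \<Rightarrow> (nat \<Rightarrow> 'v) \<Rightarrow> nat \<Rightarrow> 'v" where
  "sum_op T h = (\<lambda>i. T i (h i))"

section \<open>The space of square integrable functions modulo null sets\<close>

definition sq_integrable :: "'a measure \<Rightarrow> ('a \<Rightarrow> complex) set" where
  "sq_integrable M = {f \<in> borel_measurable M. integrable M (\<lambda>x. (cmod (f x))\<^sup>2)}"

definition ae_rel :: "'a measure \<Rightarrow> (('a \<Rightarrow> complex) \<times> ('a \<Rightarrow> complex)) set" where
  "ae_rel M = {(f, g). f \<in> sq_integrable M \<and> g \<in> sq_integrable M \<and> (AE x in M. f x = g x)}"

definition l2_class :: "'a measure \<Rightarrow> ('a \<Rightarrow> complex) \<Rightarrow> ('a \<Rightarrow> complex) set" where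
  "l2_class M f = ae_rel M `` {f}"

definition l2_rep :: "('a \<Rightarrow> complex) set \<Rightarrow> 'a \<Rightarrow> complex" where
  "l2_rep F = (SOME f. f \<in> F)"

definition L2 :: "'a measure \<Rightarrow> ('a \<Rightarrow> complex) set inner_space" where
  "L2 M =
     \<lparr>vecs = sq_integrable M // ae_rel M,
      vzero = l2_class M (\<lambda>x. 0),
      vadd = (\<lambda>F G. l2_class M (\<lambda>x. l2_rep F x + l2_rep G x)),
      vscale = (\<lambda>c F. l2_class M (\<lambda>x. c * l2_rep F x)),
      vinner = (\<lambda>F G. \<integral>x. cnj (l2_rep F x) * l2_rep G x \<partial>M)\<rparr>"

text \<open>The operations do not depend on the representatives chosen by \<open>l2_rep\<close>:\<close>

lemma equiv_ae_rel: "equiv (sq_integrable M) (ae_rel M)"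
proof (rule equivI)
  show "ae_rel M \<subseteq> sq_integrable M \<times> sq_integrable M"
    by (auto simp: ae_rel_def)
  show "refl_on (sq_integrable M) (ae_rel M)"
    by (auto simp: refl_on_def ae_rel_def)
  show "sym (ae_rel M)"
    by (auto simp: sym_def ae_rel_def elim!: eventually_mono)
  show "trans (ae_rel M)"
    unfolding trans_def ae_rel_def
    by (auto elim: eventually_elim2)
qed

lemma l2_rep_class:
  assumes "f \<in> sq_integrable M"
  shows "(f, l2_rep (l2_class M f)) \<in> ae_rel M"
proof -
  have "f \<in> l2_class M f"
    unfolding l2_class_def by (rule equiv_class_self[OF equiv_ae_rel assms])
  hence "l2_rep (l2_class M f) \<in> l2_class M f"
    unfolding l2_rep_def by (rule someI[of "\<lambda>h. h \<in> l2_class M f"])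
  thus ?thesis by (simp add: l2_class_def)
qed

lemma l2_class_eqI: "(f, g) \<in> ae_rel M \<Longrightarrow> l2_class M f = l2_class M g"
  unfolding l2_class_def by (rule equiv_class_eq[OF equiv_ae_rel])

lemma sq_integrable_add:
  assumes "f \<in> sq_integrable M" "g \<in> sq_integrable M"
  shows "(\<lambda>x. f x + g x) \<in> sq_integrable M"
proof -
  have [measurable]: "f \<in> borel_measurable M" "g \<in> borel_measurable M"
    using assms by (auto simp: sq_integrable_def)
  have bd: "(cmod (a + b))\<^sup>2 \<le> 2 * (cmod a)\<^sup>2 + 2 * (cmod b)\<^sup>2" for a b :: complex
  proof -
    have "(cmod (a + b))\<^sup>2 \<le> (cmod a + cmod b)\<^sup>2"
      by (simp add: norm_triangle_ineq power_mono)
    also have "\<dots> \<le> 2 * (cmod a)\<^sup>2 + 2 * (cmod b)\<^sup>2"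
      using zero_le_power2[of "cmod a - cmod b"]
      by (simp add: power2_eq_square algebra_simps)
    finally show ?thesis .
  qed
  have "integrable M (\<lambda>x. 2 * (cmod (f x))\<^sup>2 + 2 * (cmod (g x))\<^sup>2)"
    using assms by (auto simp: sq_integrable_def)
  hence "integrable M (\<lambda>x. (cmod (f x + g x))\<^sup>2)"
    by (rule Bochner_Integration.integrable_bound) (use bd in auto)
  thus ?thesis by (simp add: sq_integrable_def)
qed

lemma sq_integrable_scale:
  "f \<in> sq_integrable M \<Longrightarrow> (\<lambda>x. c * f x) \<in> sq_integrable M"
  by (auto simp: sq_integrable_def norm_mult power_mult_distrib)

lemma L2_add_class:
  assumes "f \<in> sq_integrable M" "g \<in> sq_integrable M"
  shows "vadd (L2 M) (l2_class M f) (l2_class M g) = l2_class M (\<lambda>x. f x + g x)"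
proof -
  let ?f = "l2_rep (l2_class M f)" and ?g = "l2_rep (l2_class M g)"
  have f: "?f \<in> sq_integrable M" "AE x in M. f x = ?f x"
    and g: "?g \<in> sq_integrable M" "AE x in M. g x = ?g x"
    using l2_rep_class[OF assms(1)] l2_rep_class[OF assms(2)] by (auto simp: ae_rel_def)
  from f(2) g(2) have "AE x in M. ?f x + ?g x = f x + g x"
    by eventually_elim simp
  with f(1) g(1) assms show ?thesis
    by (simp add: L2_def ae_rel_def sq_integrable_add l2_class_eqI)
qed

lemma L2_scale_class:
  assumes "f \<in> sq_integrable M"
  shows "vscale (L2 M) c (l2_class M f) = l2_class M (\<lambda>x. c * f x)"
proof -
  let ?f = "l2_rep (l2_class M f)"
  have f: "?f \<in> sq_integrable M" "AE x in M. f x = ?f x"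
    using l2_rep_class[OF assms] by (auto simp: ae_rel_def)
  from f(2) have "AE x in M. c * ?f x = c * f x"
    by eventually_elim simp
  with f(1) assms show ?thesis
    by (simp add: L2_def ae_rel_def sq_integrable_scale l2_class_eqI)
qed

lemma L2_inner_class:
  assumes "f \<in> sq_integrable M" "g \<in> sq_integrable M"
  shows "vinner (L2 M) (l2_class M f) (l2_class M g) = (\<integral>x. cnj (f x) * g x \<partial>M)"
proof -
  let ?f = "l2_rep (l2_class M f)" and ?g = "l2_rep (l2_class M g)"
  have f: "?f \<in> sq_integrable M" "AE x in M. f x = ?f x"
    and g: "?g \<in> sq_integrable M" "AE x in M. g x = ?g x"
    using l2_rep_class[OF assms(1)] l2_rep_class[OF assms(2)] by (auto simp: ae_rel_def)
  have [measurable]: "f \<in> borel_measurable M" "g \<in> borel_measurable M"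
    "?f \<in> borel_measurable M" "?g \<in> borel_measurable M"
    using assms f(1) g(1) by (auto simp: sq_integrable_def)
  have [measurable]: "(\<lambda>x. cnj (h x)) \<in> borel_measurable M"
    if [measurable]: "h \<in> borel_measurable M" for h
    by (intro borel_measurable_continuous_on[OF _ that] continuous_intros)
  have "(\<integral>x. cnj (?f x) * ?g x \<partial>M) = (\<integral>x. cnj (f x) * g x \<partial>M)"
  proof (rule integral_cong_AE)
    show "AE x in M. cnj (?f x) * ?g x = cnj (f x) * g x"
      using f(2) g(2) by eventually_elim simp
  qed measurable
  thus ?thesis by (simp add: L2_def)
qed

section \<open>Bernoulli convolutions, exponentials and the index set\<close>

definition tau_plus :: "real \<Rightarrow> real \<Rightarrow> real" where
  "tau_plus r x = r * (x + 1)"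

definition tau_minus :: "real \<Rightarrow> real \<Rightarrow> real" where
  "tau_minus r x = r * (x - 1)"

definition bernoulli_convolution :: "real \<Rightarrow> real measure \<Rightarrow> bool" where
  "bernoulli_convolution r \<mu> \<longleftrightarrow>
     prob_space \<mu> \<and> sets \<mu> = sets borel \<and>
     (\<forall>A\<in>sets borel.
        measure \<mu> A = 1/2 * measure (distr \<mu> borel (tau_plus r)) A
                    + 1/2 * measure (distr \<mu> borel (tau_minus r)) A)"

definition expo :: "real measure \<Rightarrow> real \<Rightarrow> (real \<Rightarrow> complex) set" where
  "expo \<mu> t = l2_class \<mu> (\<lambda>x. exp (2 * of_real pi * \<i> * of_real t * of_real x))"

definition Gam :: "nat \<Rightarrow> real set" where
  "Gam n = {\<Sum>i\<le>m. a i * (2 * real n) ^ i | (m :: nat) (a :: nat \<Rightarrow> real).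
              \<forall>i\<le>m. a i \<in> {0, real n / 2}}"

definition Gam_part :: "nat \<Rightarrow> nat \<Rightarrow> real set" where
  "Gam_part n k = (*) ((2 * real n) ^ k) ` Gam n - (*) ((2 * real n) ^ (k + 1)) ` Gam n"

text \<open>
  The blocks \<open>{0}, \<Gamma>\<^sub>0, \<Gamma>\<^sub>1, \<dots>\<close> in this order, so that \<open>\<Gamma>\<^sub>k\<close> has number \<open>k + 1\<close>.
\<close>

definition Gam_block :: "nat \<Rightarrow> nat \<Rightarrow> real set" where
  "Gam_block n i = (case i of 0 \<Rightarrow> {0} | Suc k \<Rightarrow> Gam_part n k)"

definition W_space ::
  "'v inner_space \<Rightarrow> ('v \<Rightarrow> 'v) \<Rightarrow> ('v \<Rightarrow> 'v) \<Rightarrow> nat \<Rightarrow> 'v set" where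
  "W_space H S0 S1 k = (S0 ^^ k) ` S1 ` vecs H"

text \<open>
  The Hilbert space \<open>sp{e\<^sub>0} \<oplus> W\<^sub>0 \<oplus> W\<^sub>0 \<oplus> \<dots>\<close> and the operator \<open>P \<oplus> T \<oplus> T \<oplus> \<dots>\<close> on it, where
  \<open>P\<close> is the orthogonal projection onto \<open>sp{e\<^sub>0}\<close>.
\<close>

definition model_space ::
  "'v inner_space \<Rightarrow> 'v \<Rightarrow> 'v set \<Rightarrow> (nat \<Rightarrow> 'v) inner_space" where
  "model_space H e\<^sub>0 W\<^sub>0 =
     hilbert_sum (\<lambda>i. case i of 0 \<Rightarrow> subsp H (vspan H {e\<^sub>0}) | Suc k \<Rightarrow> subsp H W\<^sub>0)"

definition model_op ::
  "'v inner_space \<Rightarrow> 'v \<Rightarrow> ('v \<Rightarrow> 'v) \<Rightarrow> (nat \<Rightarrow> 'v) \<Rightarrow> nat \<Rightarrow> 'v" where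
  "model_op H e\<^sub>0 T =
     sum_op (\<lambda>i. case i of 0 \<Rightarrow> orth_proj H (vspan H {e\<^sub>0}) | Suc k \<Rightarrow> T)"

text \<open>
  The blocks partition \<open>\<Gamma>\<close>, and \<open>\<Gamma>\<^sub>k\<close> consists of the points
  \<open>(2n)\<^sup>k (n/2 + 2n\<gamma>)\<close> with \<open>\<gamma> \<in> \<Gamma>\<close>.
\<close>

lemma zero_in_Gam: "0 \<in> Gam n"
  unfolding Gam_def by (rule CollectI, rule exI[of _ 0], rule exI[of _ "\<lambda>_. 0"]) auto

lemma Gam_step_in:
  assumes "d \<in> {0, real n / 2}" "y \<in> Gam n"
  shows "d + 2 * real n * y \<in> Gam n"
proof -
  from assms(2) obtain m a where y: "y = (\<Sum>i\<le>m. a i * (2 * real n) ^ i)"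
    and a: "\<forall>i\<le>(m::nat). a i \<in> {0, real n / 2}"
    unfolding Gam_def by blast
  let ?b = "case_nat d a"
  have eq: "d + 2 * real n * y = (\<Sum>i\<le>Suc m. ?b i * (2 * real n) ^ i)"
    unfolding y by (subst sum.atMost_Suc_shift) (simp add: sum_distrib_left mult_ac)
  have "\<forall>i\<le>Suc m. ?b i \<in> {0, real n / 2}"
    using assms(1) a by (auto split: nat.split)
  with eq show ?thesis unfolding Gam_def by blast
qed

lemma Gam_cases:
  assumes "x \<in> Gam n"
  obtains d y where "d \<in> {0, real n / 2}" "y \<in> Gam n" "x = d + 2 * real n * y"
proof -
  from assms obtain m a where x: "x = (\<Sum>i\<le>m. a i * (2 * real n) ^ i)"
    and a: "\<forall>i\<le>(m::nat). a i \<in> {0, real n / 2}"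
    unfolding Gam_def by blast
  show ?thesis
  proof (cases m)
    case 0
    show ?thesis
      by (rule that[of "a 0" 0]) (use 0 a x zero_in_Gam in auto)
  next
    case (Suc m')
    let ?y = "\<Sum>i\<le>m'. a (Suc i) * (2 * real n) ^ i"
    have "?y \<in> Gam n"
      unfolding Gam_def using a Suc
      by (intro CollectI exI[of _ m'] exI[of _ "\<lambda>i. a (Suc i)"]) auto
    moreover have "x = a 0 + 2 * real n * ?y"
      unfolding x Suc by (subst sum.atMost_Suc_shift) (simp add: sum_distrib_left mult_ac)
    ultimately show ?thesis using that a by blast
  qed
qed

lemma Gam_multiple:
  assumes "x \<in> Gam n"
  obtains N :: nat where "x = real n / 2 * real N"
proof -
  from assms obtain m a where x: "x = (\<Sum>i\<le>m. a i * (2 * real n) ^ i)"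
    and a: "\<forall>i\<le>(m::nat). a i \<in> {0, real n / 2}"
    unfolding Gam_def by blast
  have "x = real n / 2 * real (\<Sum>i\<le>m. (if a i = 0 then 0 else (2 * n) ^ i))"
    unfolding x of_nat_sum sum_distrib_left
    by (intro sum.cong refl) (use a in auto)
  thus ?thesis by (rule that)
qed

lemma Gam_odd_even_disjoint:
  assumes "n \<ge> 1" "x \<in> Gam n" "y \<in> Gam n"
  shows "real n / 2 + 2 * real n * x \<noteq> 2 * real n * y"
proof
  assume eq: "real n / 2 + 2 * real n * x = 2 * real n * y"
  obtain N M where N: "x = real n / 2 * real N" and M: "y = real n / 2 * real M"
    using Gam_multiple assms by metis
  have "real n / 2 * (1 + 2 * real n * real N) = real n / 2 * (2 * real n * real M)"
    using eq unfolding N M by (simp add: algebra_simps)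
  hence "1 + 2 * real n * real N = 2 * real n * real M"
    using assms(1) by simp
  hence "1 + 2 * n * N = 2 * n * M"
    by (metis (mono_tags, opaque_lifting) of_nat_1 of_nat_add of_nat_eq_iff of_nat_mult of_nat_numeral)
  hence "even (1 + 2 * n * N)" by simp
  thus False by simp
qed

lemma Gam_part_eq:
  assumes "n \<ge> 1"
  shows "Gam_part n k = (\<lambda>\<gamma>. (2 * real n) ^ k * (real n / 2 + 2 * real n * \<gamma>)) ` Gam n"
proof -
  have inj: "inj ((*) ((2 * real n) ^ k))"
    using assms by (auto simp: inj_on_def)
  have 0: "Gam n - (*) (2 * real n) ` Gam n = (\<lambda>\<gamma>. real n / 2 + 2 * real n * \<gamma>) ` Gam n"
  proof (intro set_eqI iffI)
    fix x assume x: "x \<in> Gam n - (*) (2 * real n) ` Gam n"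
    then obtain d y where d: "d \<in> {0, real n / 2}" and y: "y \<in> Gam n"
      and eq: "x = d + 2 * real n * y" by (blast elim: Gam_cases)
    have "d \<noteq> 0" using x y eq by auto
    hence "x = real n / 2 + 2 * real n * y" using d eq by simp
    with y show "x \<in> (\<lambda>\<gamma>. real n / 2 + 2 * real n * \<gamma>) ` Gam n" by blast
  next
    fix x assume "x \<in> (\<lambda>\<gamma>. real n / 2 + 2 * real n * \<gamma>) ` Gam n"
    then obtain y where y: "y \<in> Gam n" and eq: "x = real n / 2 + 2 * real n * y" by blast
    have "x \<in> Gam n" unfolding eq by (rule Gam_step_in[OF _ y]) simp
    moreover have "x \<notin> (*) (2 * real n) ` Gam n"
      using Gam_odd_even_disjoint[OF assms y] unfolding eq by blast
    ultimately show "x \<in> Gam n - (*) (2 * real n) ` Gam n" by blast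
  qed
  have "Gam_part n k = (*) ((2 * real n) ^ k) ` (Gam n - (*) (2 * real n) ` Gam n)"
    unfolding Gam_part_def image_set_diff[OF inj] image_image by (simp add: mult_ac)
  thus ?thesis unfolding 0 image_image .
qed

lemma Gam_scaled_mono:
  assumes "j \<le> k"
  shows "(*) ((2 * real n) ^ k) ` Gam n \<subseteq> (*) ((2 * real n) ^ j) ` Gam n"
  using assms
proof (induction k rule: dec_induct)
  case (step k)
  have closed: "2 * real n * x \<in> Gam n" if "x \<in> Gam n" for x
    using Gam_step_in[of 0 n x] that by simp
  hence "(*) ((2 * real n) ^ Suc k) ` Gam n \<subseteq> (*) ((2 * real n) ^ k) ` Gam n"
  proof (intro subsetI, elim imageE)
    fix x y assume "x = (2 * real n) ^ Suc k * y" "y \<in> Gam n"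
    thus "x \<in> (*) ((2 * real n) ^ k) ` Gam n"
      using closed by (intro image_eqI[of _ _ "2 * real n * y"]) simp_all
  qed
  with step show ?case by blast
qed simp

lemma Gam_blocks_cover:
  assumes "n \<ge> 1"
  shows "(\<Union>i. Gam_block n i) = Gam n"
proof (intro equalityI subsetI)
  fix x assume "x \<in> (\<Union>i. Gam_block n i)"
  then obtain i where "x \<in> Gam_block n i" by blast
  thus "x \<in> Gam n"
    using Gam_scaled_mono[of 0 "i - 1" n] zero_in_Gam
    by (auto simp: Gam_block_def Gam_part_def split: nat.splits)
next
  fix x assume "x \<in> Gam n"
  then obtain N where "x = real n / 2 * real N" by (rule Gam_multiple)
  with \<open>x \<in> Gam n\<close> have "x = 0 \<or> (\<exists>k. x \<in> Gam_part n k)"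
  proof (induction N arbitrary: x rule: less_induct)
    case (less N)
    from less.prems(1) obtain d y where d: "d \<in> {0, real n / 2}" and y: "y \<in> Gam n"
      and x: "x = d + 2 * real n * y" by (rule Gam_cases)
    show ?case
    proof (cases "d = 0 \<and> x \<noteq> 0")
      case False
      show ?thesis
      proof (cases "x = 0")
        case x0: False
        with False d have "d = real n / 2" by auto
        hence "x \<in> Gam_part n 0"
          unfolding Gam_part_eq[OF assms] x using y by (intro image_eqI[of _ _ y]) simp_all
        thus ?thesis by blast
      qed simp
    next
      case True
      obtain M where M: "y = real n / 2 * real M" using y by (rule Gam_multiple)
      have "real n / 2 * real N = real n / 2 * (2 * real n * real M)"
        using less.prems(2) x True M by simp
      hence "real N = 2 * real n * real M" using assms by simp
      hence NM: "N = 2 * n * M"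
        by (metis (mono_tags, opaque_lifting) of_nat_eq_iff of_nat_mult of_nat_numeral)
      have "M \<noteq> 0" using True x M by auto
      hence "M < N" using NM assms by simp
      from less.IH[OF this y M] True x obtain k where "y \<in> Gam_part n k" by auto
      hence "x \<in> Gam_part n (Suc k)"
        using x True by (auto simp: Gam_part_eq[OF assms])
      thus ?thesis by blast
    qed
  qed
  thus "x \<in> (\<Union>i. Gam_block n i)"
  proof
    assume "x = 0"
    hence "x \<in> Gam_block n 0" by (simp add: Gam_block_def)
    thus ?thesis by blast
  next
    assume "\<exists>k. x \<in> Gam_part n k"
    then obtain k where "x \<in> Gam_block n (Suc k)" by (auto simp: Gam_block_def)
    thus ?thesis by blast
  qed
qed

lemma Gam_blocks_disjoint: "disjoint_family (Gam_block n)"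
proof -
  have 0: "0 \<notin> Gam_part n k" for k
    using zero_in_Gam by (force simp: Gam_part_def)
  have 1: "Gam_part n j \<inter> Gam_part n k = {}" if "j < k" for j k
    using Gam_scaled_mono[of "j + 1" k n] that by (auto simp: Gam_part_def)
  have "Gam_part n j \<inter> Gam_part n k = {}" if "j \<noteq> k" for j k
    using 1[of j k] 1[of k j] that by (cases "j < k") auto
  thus ?thesis using 0
    by (auto simp: disjoint_family_on_def Gam_block_def split: nat.split)
qed

end

theory Submission
  imports Defs
begin

text \<open>
  By self-similarity the Fourier transform \<open>F\<close> of \<open>\<mu>\<close> satisfies \<open>F(2ns) = cos(2\<pi>s) F(s)\<close>. Every element of
  \<open>\<Gamma>\<^sub>k\<close> is \<open>(2n)\<^sup>k n/2\<close> times an odd integer, so for \<open>\<xi>\<close> and \<open>\<gamma>\<close> in different blocks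
  \<open>p\<gamma> - \<xi>\<close> is again an odd multiple of some \<open>(2n)\<^sup>j n/2\<close>, where a factor \<open>cos\<close> at an odd multiple
  of \<open>\<pi>/2\<close> occurs; within one block \<open>p\<gamma> - \<xi>\<close> is \<open>(2n)\<^sup>k\<close> times an integer multiple of \<open>n\<close>,
  and scaling by \<open>(2n)\<^sup>k\<close> contributes only factors \<open>cos(2\<pi>m) = 1\<close>.
  With \<open>T k = S\<^sub>0\<^sup>k S\<^sub>1\<close>, the unitary equivalence sends \<open>x\<close> to the sequence with entries
  \<open>\<langle>e\<^sub>0, x\<rangle> e\<^sub>0\<close> and \<open>T 0 ((T k)\<^sup>* x)\<close>; it is isometric by Parseval, onto by Riesz--Fischer, and it
  intertwines the operators because their matrices agree.
\<close>

section \<open>Hilbert spaces with explicit carrier\<close>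

text \<open>The matrix identities compare inner products of basis vectors, while the equivalence
  concerns operators on all of L^2. The bridge is that a bounded linear functional is determined by
  its values on an orthonormal basis. Inner products are linear in the second argument only, so the
  varying vector is kept there whenever this is used. In the model all summands after the first are
  the same W_0, so the component of a vector in W_k has to be transported: the adjoint of
  \<open>T k\<close> undoes \<open>T k\<close>, and \<open>T 0\<close> places the result in W_0. The
  invariance of W_0 under \<open>U\<close> comes out of the vanishing off-diagonal entries. Adjoints
  are assembled from coefficients by Riesz-Fischer. The vectors e_0 and T_k e_\<gamma> are
  E(\<Gamma>) listed block by block, so they inherit completeness from it. Their orthonormality as a
  family with indices requires that distinct frequencies give orthogonal vectors, which a statement
  about the set E(\<Gamma>) does not contain; it is derived from the functional equation of
  F.\<close>

text \<open>
  All equations between vectors, including the vector space laws, follow from the separation axiom.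
\<close>

locale pre_hilbert =
  fixes H :: "'v inner_space"
  assumes zero_mem [simp]: "vzero H \<in> vecs H"
    and add_mem [simp]: "x \<in> vecs H \<Longrightarrow> y \<in> vecs H \<Longrightarrow> vadd H x y \<in> vecs H"
    and scale_mem [simp]: "x \<in> vecs H \<Longrightarrow> vscale H c x \<in> vecs H"
    and inner_zero_right [simp]: "x \<in> vecs H \<Longrightarrow> vinner H x (vzero H) = 0"
    and inner_add_right [simp]: "x \<in> vecs H \<Longrightarrow> y \<in> vecs H \<Longrightarrow> z \<in> vecs H \<Longrightarrow>
      vinner H x (vadd H y z) = vinner H x y + vinner H x z"
    and inner_scale_right [simp]: "x \<in> vecs H \<Longrightarrow> y \<in> vecs H \<Longrightarrow>
      vinner H x (vscale H c y) = c * vinner H x y"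
    and inner_commute: "x \<in> vecs H \<Longrightarrow> y \<in> vecs H \<Longrightarrow> vinner H y x = cnj (vinner H x y)"
    and inner_self_nonneg: "x \<in> vecs H \<Longrightarrow> 0 \<le> Re (vinner H x x)"
    and inner_separating: "x \<in> vecs H \<Longrightarrow> y \<in> vecs H \<Longrightarrow>
      (\<And>z. z \<in> vecs H \<Longrightarrow> vinner H z x = vinner H z y) \<Longrightarrow> x = y"

definition bounded_functional :: "'v inner_space \<Rightarrow> ('v \<Rightarrow> complex) \<Rightarrow> bool" where
  "bounded_functional H f \<longleftrightarrow>
     (\<forall>x\<in>vecs H. \<forall>y\<in>vecs H. f (vadd H x y) = f x + f y) \<and>
     (\<forall>c. \<forall>x\<in>vecs H. f (vscale H c x) = c * f x) \<and>
     (\<exists>C. \<forall>x\<in>vecs H. cmod (f x) \<le> C * vnorm H x)"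

text \<open>\<open>orthonormal_basis\<close> concerns a set, in which two indices with equal vectors
  would collapse to one element. Coefficient sums run over indices, so orthonormality is recorded
  for the indexed family.\<close>

definition orthonormal_family :: "'v inner_space \<Rightarrow> ('i \<Rightarrow> 'v) \<Rightarrow> 'i set \<Rightarrow> bool" where
  "orthonormal_family H e J \<longleftrightarrow>
     (\<forall>j\<in>J. e j \<in> vecs H) \<and>
     (\<forall>i\<in>J. \<forall>j\<in>J. vinner H (e i) (e j) = (if i = j then 1 else 0))"

text \<open>Uniqueness of the described vector is \<open>inner_separating\<close>; existence is
  shown for isometries, in \<open>adjoint_exists\<close>.\<close>

definition adjoint_op :: "'v inner_space \<Rightarrow> ('v \<Rightarrow> 'v) \<Rightarrow> 'v \<Rightarrow> 'v" where
  "adjoint_op H T x =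
     (THE y. y \<in> vecs H \<and> (\<forall>z\<in>vecs H. vinner H z y = vinner H (T z) x))"

lemma orthonormal_familyD:
  assumes "orthonormal_family H e J"
  shows "j \<in> J \<Longrightarrow> e j \<in> vecs H"
    and "i \<in> J \<Longrightarrow> j \<in> J \<Longrightarrow> vinner H (e i) (e j) = (if i = j then 1 else 0)"
  using assms by (auto simp: orthonormal_family_def)

lemma orthonormal_family_reindex:
  assumes "orthonormal_family H e I" "inj_on f J" "f ` J \<subseteq> I" "\<And>j. j \<in> J \<Longrightarrow> e' j = e (f j)"
  shows "orthonormal_family H e' J"
  unfolding orthonormal_family_def
proof (intro conjI ballI)
  have f: "f j \<in> I" if "j \<in> J" for j using assms(3) that by blast
  show "e' j \<in> vecs H" if "j \<in> J" for j
    using orthonormal_familyD(1)[OF assms(1) f] assms(4) that by simp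
  show "vinner H (e' i) (e' j) = (if i = j then 1 else 0)" if "i \<in> J" "j \<in> J" for i j
    using orthonormal_familyD(2)[OF assms(1) f f] assms(4) inj_on_eq_iff[OF assms(2)] that by simp
qed

section \<open>Inner product identities, Cauchy-Schwarz and the triangle inequality\<close>

context pre_hilbert
begin

lemma inner_zero_left [simp]: "x \<in> vecs H \<Longrightarrow> vinner H (vzero H) x = 0"
  by (subst inner_commute[of x]) simp_all

lemma inner_add_left [simp]: "x \<in> vecs H \<Longrightarrow> y \<in> vecs H \<Longrightarrow> z \<in> vecs H \<Longrightarrow>
    vinner H (vadd H y z) x = vinner H y x + vinner H z x"
  by (simp add: inner_commute[of x "vadd H y z"] inner_commute[of x y] inner_commute[of x z])

lemma inner_scale_left [simp]: "x \<in> vecs H \<Longrightarrow> y \<in> vecs H \<Longrightarrow>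
    vinner H (vscale H c y) x = cnj c * vinner H y x"
  by (simp add: inner_commute[of x "vscale H c y"] inner_commute[of x y])

lemma diff_mem [simp]: "x \<in> vecs H \<Longrightarrow> y \<in> vecs H \<Longrightarrow> vdiff H x y \<in> vecs H"
  by (simp add: vdiff_def)

lemma inner_diff_right [simp]: "x \<in> vecs H \<Longrightarrow> y \<in> vecs H \<Longrightarrow> z \<in> vecs H \<Longrightarrow>
    vinner H x (vdiff H y z) = vinner H x y - vinner H x z"
  by (simp add: vdiff_def)

lemma inner_diff_left [simp]: "x \<in> vecs H \<Longrightarrow> y \<in> vecs H \<Longrightarrow> z \<in> vecs H \<Longrightarrow>
    vinner H (vdiff H y z) x = vinner H y x - vinner H z x"
  by (simp add: vdiff_def)

lemma norm_nonneg [simp]: "x \<in> vecs H \<Longrightarrow> 0 \<le> vnorm H x"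
  by (simp add: vnorm_def inner_self_nonneg)

lemma norm_sq: "x \<in> vecs H \<Longrightarrow> (vnorm H x)\<^sup>2 = Re (vinner H x x)"
  by (simp add: vnorm_def inner_self_nonneg)

lemma inner_self: "x \<in> vecs H \<Longrightarrow> vinner H x x = complex_of_real ((vnorm H x)\<^sup>2)"
  using inner_commute[of x x] by (auto simp: norm_sq complex_eq_iff)

lemma norm_zero [simp]: "vnorm H (vzero H) = 0"
  by (simp add: vnorm_def)

lemma norm_scale: "x \<in> vecs H \<Longrightarrow> vnorm H (vscale H c x) = cmod c * vnorm H x"
proof -
  assume x: "x \<in> vecs H"
  have "vinner H (vscale H c x) (vscale H c x) = of_real ((cmod c)\<^sup>2 * (vnorm H x)\<^sup>2)"
    using x by (simp add: inner_self[OF x] complex_norm_square mult_ac flip: of_real_power)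
  thus ?thesis using x
    by (simp add: vnorm_def[of H "vscale H c x"] real_sqrt_mult)
qed

lemma Cauchy_Schwarz:
  assumes x: "x \<in> vecs H" and y: "y \<in> vecs H"
  shows "cmod (vinner H x y) \<le> vnorm H x * vnorm H y"
proof -
  define c where "c = vinner H y x"
  have c': "vinner H x y = cnj c" unfolding c_def by (rule inner_commute[OF y x])
  \<comment> \<open>This expands the squared norm of x - t c y, a real quadratic in t. Division by
    the norm of y is possible only if it is nonzero; if it is zero, the term in t^2 drops out and
    the remaining linear function of t would become negative unless c = 0.\<close>
  have quad: "0 \<le> (vnorm H x)\<^sup>2 - 2 * t * (cmod c)\<^sup>2 + t\<^sup>2 * (cmod c)\<^sup>2 * (vnorm H y)\<^sup>2" for t
  proof -
    let ?d = "vdiff H x (vscale H (of_real t * c) y)"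
    have "vinner H ?d ?d = of_real ((vnorm H x)\<^sup>2 - 2 * t * (cmod c)\<^sup>2 + t\<^sup>2 * (cmod c)\<^sup>2 * (vnorm H y)\<^sup>2)"
      using x y unfolding of_real_add of_real_diff of_real_mult complex_norm_square
      by (simp add: inner_self[OF x] inner_self[OF y] c' c_def[symmetric] algebra_simps power2_eq_square)
    thus ?thesis using inner_self_nonneg[of ?d] x y by simp
  qed
  have "(cmod c)\<^sup>2 \<le> (vnorm H x)\<^sup>2 * (vnorm H y)\<^sup>2"
  proof (cases "vnorm H y = 0")
    case True
    have "c = 0"
    proof (rule ccontr)
      assume "c \<noteq> 0"
      hence "(cmod c)\<^sup>2 > 0" by simp
      \<comment> \<open>For this t the quadratic takes the value -1.\<close>
      with quad[of "((vnorm H x)\<^sup>2 + 1) / (2 * (cmod c)\<^sup>2)"] show False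
        using True by (simp add: field_simps)
    qed
    thus ?thesis by simp
  next
    case False
    hence "(vnorm H y)\<^sup>2 > 0" by simp
    moreover have "(1 / q)\<^sup>2 * d * q = 1 / q * d" if "q > 0" for q d :: real
      using that by (simp add: power2_eq_square)
    ultimately show ?thesis
      using quad[of "1 / (vnorm H y)\<^sup>2"] by (simp add: field_simps)
  qed
  hence "(cmod c)\<^sup>2 \<le> (vnorm H x * vnorm H y)\<^sup>2" by (simp add: power_mult_distrib)
  hence "cmod c \<le> vnorm H x * vnorm H y"
    by (rule power2_le_imp_le) (use x y in simp)
  thus ?thesis by (simp add: c')
qed

lemma norm_add_le:
  assumes "x \<in> vecs H" "y \<in> vecs H"
  shows "vnorm H (vadd H x y) \<le> vnorm H x + vnorm H y"
proof (rule power2_le_imp_le)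
  have "(vnorm H (vadd H x y))\<^sup>2 = (vnorm H x)\<^sup>2 + (vnorm H y)\<^sup>2 + 2 * Re (vinner H x y)"
    using assms by (simp add: norm_sq inner_commute[of x y])
  also have "Re (vinner H x y) \<le> vnorm H x * vnorm H y"
    using Cauchy_Schwarz[OF assms] complex_Re_le_cmod[of "vinner H x y"] by linarith
  finally show "(vnorm H (vadd H x y))\<^sup>2 \<le> (vnorm H x + vnorm H y)\<^sup>2"
    by (simp add: power2_sum)
qed (use assms in simp)

lemma norm_diff_triangle:
  assumes "x \<in> vecs H" "y \<in> vecs H" "z \<in> vecs H"
  shows "vnorm H (vdiff H x z) \<le> vnorm H (vdiff H x y) + vnorm H (vdiff H y z)"
proof -
  have "vdiff H x z = vadd H (vdiff H x y) (vdiff H y z)"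
    using assms by (intro inner_separating) simp_all
  thus ?thesis using assms norm_add_le[of "vdiff H x y" "vdiff H y z"] by simp
qed

section \<open>Isometries\<close>

lemma linear_op_mem: "linear_op H H T \<Longrightarrow> x \<in> vecs H \<Longrightarrow> T x \<in> vecs H"
  by (auto simp: linear_op_def)

lemma isometry_mem: "isometry_op H H T \<Longrightarrow> x \<in> vecs H \<Longrightarrow> T x \<in> vecs H"
  by (auto simp: isometry_op_def linear_op_def)

text \<open>Polarization: expanding the norm of a sum gives the real parts, and replacing y by \<i>
  y turns the imaginary part into a real part.\<close>

lemma isometry_inner:
  assumes T: "isometry_op H H T" and x: "x \<in> vecs H" and y: "y \<in> vecs H"
  shows "vinner H (T x) (T y) = vinner H x y"
proof -
  have add: "T (vadd H u v) = vadd H (T u) (T v)" if "u \<in> vecs H" "v \<in> vecs H" for u v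
    using T that by (simp add: isometry_op_def linear_op_def)
  have scale: "T (vscale H c u) = vscale H c (T u)" if "u \<in> vecs H" for u c
    using T that by (simp add: isometry_op_def linear_op_def)
  have norm: "Re (vinner H (T u) (T u)) = Re (vinner H u u)" if "u \<in> vecs H" for u
    using T that norm_sq[of u] norm_sq[of "T u"] isometry_mem[OF T that]
    by (simp add: isometry_op_def)
  have re: "Re (vinner H (T u) (T v)) = Re (vinner H u v)"
    if u: "u \<in> vecs H" and v: "v \<in> vecs H" for u v
    using norm[of "vadd H u v"] norm[OF u] norm[OF v] u v isometry_mem[OF T u] isometry_mem[OF T v]
    by (simp add: add inner_commute[of u v] inner_commute[of "T u" "T v"])
  have "Re (vinner H (T x) (T (vscale H \<i> y))) = Re (vinner H x (vscale H \<i> y))"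
    using re x y by simp
  hence "Im (vinner H (T x) (T y)) = Im (vinner H x y)"
    using x y isometry_mem[OF T x] isometry_mem[OF T y] by (simp add: scale)
  with re[OF x y] show ?thesis by (simp add: complex_eq_iff)
qed

lemma isometry_comp:
  assumes "isometry_op H H S" "isometry_op H H T"
  shows "isometry_op H H (\<lambda>x. S (T x))"
  using assms by (auto simp: isometry_op_def linear_op_def Pi_iff)

lemma isometry_funpow:
  assumes "isometry_op H H T"
  shows "isometry_op H H (T ^^ k)"
proof (induction k)
  case (Suc k)
  show ?case using isometry_comp[OF assms Suc] by (simp add: comp_def)
qed (auto simp: isometry_op_def linear_op_def)

section \<open>Functionals and vectors determined by a basis\<close>

lemma bounded_functional_inner:
  assumes z: "z \<in> vecs H" and T: "linear_op H H T"
    and bd: "\<And>x. x \<in> vecs H \<Longrightarrow> vnorm H (T x) \<le> vnorm H x"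
  shows "bounded_functional H (\<lambda>x. vinner H z (T x))"
proof -
  have "cmod (vinner H z (T x)) \<le> vnorm H z * vnorm H x" if x: "x \<in> vecs H" for x
  proof -
    have "cmod (vinner H z (T x)) \<le> vnorm H z * vnorm H (T x)"
      by (intro Cauchy_Schwarz z linear_op_mem[OF T x])
    also have "\<dots> \<le> vnorm H z * vnorm H x"
      using bd[OF x] z by (intro mult_left_mono) simp_all
    finally show ?thesis .
  qed
  thus ?thesis using T z linear_op_mem[OF T]
    by (auto simp: bounded_functional_def linear_op_def)
qed

lemma bounded_functional_inner_isometry:
  "z \<in> vecs H \<Longrightarrow> isometry_op H H T \<Longrightarrow> bounded_functional H (\<lambda>x. vinner H z (T x))"
  by (rule bounded_functional_inner) (simp_all add: isometry_op_def)

lemma isometry_id: "isometry_op H H (\<lambda>x. x)"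
  by (simp add: isometry_op_def linear_op_def)

lemma bounded_functional_diff:
  assumes "bounded_functional H f" "bounded_functional H g"
  shows "bounded_functional H (\<lambda>x. f x - g x)"
proof -
  obtain C D where "\<forall>x\<in>vecs H. cmod (f x) \<le> C * vnorm H x" "\<forall>x\<in>vecs H. cmod (g x) \<le> D * vnorm H x"
    using assms unfolding bounded_functional_def by metis
  hence "\<forall>x\<in>vecs H. cmod (f x - g x) \<le> (C + D) * vnorm H x"
    by (smt (verit) norm_triangle_ineq4 distrib_right)
  hence "\<exists>C. \<forall>x\<in>vecs H. cmod (f x - g x) \<le> C * vnorm H x" by blast
  with assms show ?thesis
    unfolding bounded_functional_def by (simp add: algebra_simps)
qed

text \<open>The difference h vanishes on the span of \<open>B\<close>, and boundedness carries this
  to the closure, which is the whole space. This is the tool that turns equal matrix entries into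
  equal operators.\<close>

lemma bounded_functional_eq_on_basis:
  assumes f: "bounded_functional H f" and g: "bounded_functional H g"
    and B: "orthonormal_basis H B" and eq: "\<And>b. b \<in> B \<Longrightarrow> f b = g b" and x: "x \<in> vecs H"
  shows "f x = g x"
proof -
  define h where "h x = f x - g x" for x
  have "bounded_functional H h" unfolding h_def by (rule bounded_functional_diff[OF f g])
  then obtain C where add: "\<And>u v. u \<in> vecs H \<Longrightarrow> v \<in> vecs H \<Longrightarrow> h (vadd H u v) = h u + h v"
    and scale: "\<And>u c. u \<in> vecs H \<Longrightarrow> h (vscale H c u) = c * h u"
    and C: "\<And>u. u \<in> vecs H \<Longrightarrow> cmod (h u) \<le> C * vnorm H u"
    unfolding bounded_functional_def by metis
  have span: "y \<in> vecs H \<and> h y = 0" if "y \<in> vspan H B" for y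
    using that
  proof induction
    case zero
    show ?case using C[of "vzero H"] by simp
  next
    case (base b)
    thus ?case using B eq by (auto simp: orthonormal_basis_def h_def)
  qed (simp_all add: add scale)
  have "cmod (h x) \<le> 0 + \<epsilon>" if "\<epsilon> > 0" for \<epsilon>
  proof -
    have "x \<in> vclosure H (vspan H B)" using B x by (simp add: orthonormal_basis_def)
    \<comment> \<open>The constant \<open>C\<close> may be zero or negative, hence the positive
      bound \<bar>C\<bar> + 1.\<close>
    hence "\<exists>y\<in>vspan H B. vnorm H (vdiff H x y) < \<epsilon> / (\<bar>C\<bar> + 1)"
      using that by (simp add: vclosure_def)
    then obtain y where y: "y \<in> vspan H B" and xy: "vnorm H (vdiff H x y) < \<epsilon> / (\<bar>C\<bar> + 1)"
      by blast
    have d: "vdiff H x y \<in> vecs H" using span[OF y] x by simp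
    have "h x = h (vdiff H x y)" using span[OF y] x by (simp add: vdiff_def add scale)
    hence "cmod (h x) \<le> C * vnorm H (vdiff H x y)" using C[OF d] by simp
    also have "\<dots> \<le> (\<bar>C\<bar> + 1) * vnorm H (vdiff H x y)"
      using d by (intro mult_right_mono) auto
    also have "\<dots> \<le> \<epsilon>" using xy by (simp add: field_simps)
    finally show ?thesis by simp
  qed
  hence "cmod (h x) \<le> 0" by (rule field_le_epsilon)
  thus ?thesis by (simp add: h_def)
qed

text \<open>The hypothesis has the basis vector in the conjugate linear argument, so both sides are
  conjugated before they are compared as linear functionals.\<close>

lemma eq_if_inner_basis_eq:
  assumes B: "orthonormal_basis H B" and x: "x \<in> vecs H" and y: "y \<in> vecs H"
    and eq: "\<And>b. b \<in> B \<Longrightarrow> vinner H b x = vinner H b y"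
  shows "x = y"
  using x y
proof (rule inner_separating)
  fix z assume z: "z \<in> vecs H"
  have "vinner H x b = vinner H y b" if "b \<in> B" for b
  proof -
    have "b \<in> vecs H" using that B by (auto simp: orthonormal_basis_def)
    thus ?thesis using eq[OF that] x y by (simp add: inner_commute[of b])
  qed
  hence "vinner H x z = vinner H y z"
    using bounded_functional_eq_on_basis[OF bounded_functional_inner_isometry[OF x isometry_id]
      bounded_functional_inner_isometry[OF y isometry_id] B _ z] by blast
  thus "vinner H z x = vinner H z y" using x y z by (simp add: inner_commute[of _ z])
qed

section \<open>Finite linear combinations and Bessel's inequality\<close>

text \<open>Finite sums are never formed in the carrier: a combination is handled solely through its
  inner products, which determine it by \<open>inner_separating\<close>.\<close>

lemma finite_combination:
  assumes "finite F" "\<And>j. j \<in> F \<Longrightarrow> e j \<in> vecs H"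
  shows "\<exists>x\<in>vecs H. \<forall>y\<in>vecs H. vinner H y x = (\<Sum>j\<in>F. a j * vinner H y (e j))"
  using assms
proof (induction F rule: finite_induct)
  case empty
  show ?case by (intro bexI[of _ "vzero H"]) simp_all
next
  case (insert j F)
  then obtain x where "x \<in> vecs H" "\<forall>y\<in>vecs H. vinner H y x = (\<Sum>j\<in>F. a j * vinner H y (e j))"
    by auto
  with insert show ?case
    by (intro bexI[of _ "vadd H (vscale H (a j) (e j)) x"]) auto
qed

lemma norm_sq_combination:
  assumes e: "orthonormal_family H e J" and F: "finite F" "F \<subseteq> J" and x: "x \<in> vecs H"
    and comb: "\<And>y. y \<in> vecs H \<Longrightarrow> vinner H y x = (\<Sum>j\<in>F. a j * vinner H y (e j))"
  shows "(vnorm H x)\<^sup>2 = (\<Sum>j\<in>F. (cmod (a j))\<^sup>2)"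
proof -
  have "vinner H x (e j) = cnj (a j)" if j: "j \<in> F" for j
  proof -
    have ej: "e j \<in> vecs H" using e F j by (auto simp: orthonormal_family_def)
    have "vinner H (e j) x = (\<Sum>i\<in>F. a i * (if j = i then 1 else 0))"
      unfolding comb[OF ej] using orthonormal_familyD(2)[OF e] F j
      by (intro sum.cong) (simp_all add: subset_iff)
    also have "\<dots> = a j" using F j by (simp add: mult_delta_right)
    finally show ?thesis using inner_commute[OF ej x] by simp
  qed
  hence "vinner H x x = (\<Sum>j\<in>F. a j * cnj (a j))" unfolding comb[OF x] by simp
  also have "\<dots> = of_real (\<Sum>j\<in>F. (cmod (a j))\<^sup>2)"
    by (simp add: complex_norm_square[symmetric])
  finally show ?thesis by (simp add: norm_sq[OF x])
qed

lemma Bessel: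
  assumes e: "orthonormal_family H e J" and F: "finite F" "F \<subseteq> J" and x: "x \<in> vecs H"
  shows "(\<Sum>j\<in>F. (cmod (vinner H (e j) x))\<^sup>2) \<le> (vnorm H x)\<^sup>2"
proof -
  let ?a = "\<lambda>j. vinner H (e j) x" and ?s = "\<Sum>j\<in>F. (cmod (vinner H (e j) x))\<^sup>2"
  have ej: "e j \<in> vecs H" if "j \<in> F" for j using e F that by (auto simp: orthonormal_family_def)
  obtain y where y: "y \<in> vecs H"
    and comb: "\<And>z. z \<in> vecs H \<Longrightarrow> vinner H z y = (\<Sum>j\<in>F. ?a j * vinner H z (e j))"
    using finite_combination[of F e ?a, OF F(1) ej] by blast
  have "vinner H x y = (\<Sum>j\<in>F. ?a j * cnj (?a j))"
    unfolding comb[OF x] by (intro sum.cong refl) (simp add: inner_commute[OF ej x])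
  also have "\<dots> = of_real ?s" by (simp add: complex_norm_square[symmetric])
  finally have xy: "vinner H x y = of_real ?s" .
  have "vinner H y x = of_real ?s" using inner_commute[OF x y] xy by simp
  hence "Re (vinner H (vdiff H x y) (vdiff H x y)) = (vnorm H x)\<^sup>2 - ?s"
    using x y xy norm_sq_combination[OF e F y comb] by (simp add: inner_self[OF x] inner_self[OF y])
  thus ?thesis using inner_self_nonneg[of "vdiff H x y"] x y by simp
qed

lemma coefficients_summable:
  assumes e: "orthonormal_family H e J" and x: "x \<in> vecs H"
  shows "(\<lambda>j. (cmod (vinner H (e j) x))\<^sup>2) summable_on J"
proof (rule nonneg_bdd_above_summable_on)
  show "bdd_above (sum (\<lambda>j. (cmod (vinner H (e j) x))\<^sup>2) ` {F. F \<subseteq> J \<and> finite F})"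
    using Bessel[OF e _ _ x] by (intro bdd_aboveI[of _ "(vnorm H x)\<^sup>2"]) auto
qed simp

end

section \<open>Completeness: Riesz-Fischer, Parseval and adjoints of isometries\<close>

lemma LIMSEQ_if_norm_diff_le:
  fixes f :: "nat \<Rightarrow> 'a::real_normed_vector"
  assumes "\<And>n. norm (f n - l) \<le> g n" "g \<longlonglongrightarrow> 0"
  shows "f \<longlonglongrightarrow> l"
  using Lim_null_comparison[OF always_eventually[OF allI[OF assms(1)]] assms(2)] Lim_null[of f l sequentially]
  by blast

text \<open>Completeness is stated for sequences with summable increments. Every Cauchy sequence has
  such a subsequence, and this form fits both the partial sums in \<open>Riesz_Fischer\<close> and
  the telescoping argument for L^2.\<close>

locale hilbert = pre_hilbert H for H :: "'v inner_space" +
  assumes complete: "(\<And>n::nat. X n \<in> vecs H) \<Longrightarrow>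
      summable (\<lambda>n. vnorm H (vdiff H (X (Suc n)) (X n))) \<Longrightarrow>
      \<exists>x\<in>vecs H. (\<lambda>n. vnorm H (vdiff H (X n) x)) \<longlonglongrightarrow> 0"
begin

lemma Riesz_Fischer:
  assumes e: "orthonormal_family H e J" and sm: "(\<lambda>j. (cmod (a j))\<^sup>2) summable_on J"
  shows "\<exists>x\<in>vecs H. (\<forall>j\<in>J. vinner H (e j) x = a j) \<and> ((\<lambda>j. (cmod (a j))\<^sup>2) has_sum (vnorm H x)\<^sup>2) J"
proof -
  let ?q = "\<lambda>j. (cmod (a j))\<^sup>2"
  define s where "s = infsum ?q J"
  have hs: "(?q has_sum s) J" unfolding s_def using sm by simp
  have le: "sum ?q F \<le> s" if "finite F" "F \<subseteq> J" for F
    unfolding s_def by (rule finite_sum_le_infsum[OF sm that]) simp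
  \<comment> \<open>The index set carries no order, so partial sums are taken over finite sets that
    miss at most mass 4^(-n); the increments of the partial sums then have norm at most
    2^(-n).\<close>
  have "\<exists>F. finite F \<and> F \<subseteq> J \<and> s - sum ?q F \<le> (1/4) ^ n" for n :: nat
    using has_sum_finite_approximation[OF hs, of "(1/4) ^ n"] le
    by (auto simp: dist_real_def abs_le_iff)
  then obtain F where F: "\<And>n. finite (F n)" "\<And>n. F n \<subseteq> J" "\<And>n. s - sum ?q (F n) \<le> (1/4) ^ n"
    by metis
  \<comment> \<open>The sets \<open>F n\<close> need not be nested. Their unions are, so that a
    difference of successive partial sums is again a combination over a finite set.\<close>
  define G where "G n = (\<Union>i\<le>n. F i)" for n
  have G: "finite (G n)" "G n \<subseteq> J" "G n \<subseteq> G (Suc n)" for n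
    using F by (auto simp: G_def intro: le_SucI)
  have tail: "s - sum ?q (G n) \<le> (1/4) ^ n" for n
  proof -
    have "sum ?q (F n) \<le> sum ?q (G n)" by (rule sum_mono2) (auto simp: G_def F)
    thus ?thesis using F(3)[of n] by simp
  qed
  have ej: "e j \<in> vecs H" if "j \<in> J" for j using e that by (simp add: orthonormal_family_def)
  have "\<exists>x\<in>vecs H. \<forall>y\<in>vecs H. vinner H y x = (\<Sum>j\<in>G n. a j * vinner H y (e j))" for n
    using G(2) ej by (intro finite_combination G(1)) blast
  then obtain X where X: "\<And>n. X n \<in> vecs H"
    and comb: "\<And>n y. y \<in> vecs H \<Longrightarrow> vinner H y (X n) = (\<Sum>j\<in>G n. a j * vinner H y (e j))"
    by metis
  have "norm (vnorm H (vdiff H (X (Suc n)) (X n))) \<le> (1/2) ^ n" for n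
  proof -
    let ?d = "vdiff H (X (Suc n)) (X n)"
    have d: "?d \<in> vecs H" using X by simp
    have "vinner H y ?d = (\<Sum>j\<in>G (Suc n) - G n. a j * vinner H y (e j))" if "y \<in> vecs H" for y
      using that X G by (simp add: comb sum_diff)
    hence "(vnorm H ?d)\<^sup>2 = (\<Sum>j\<in>G (Suc n) - G n. ?q j)"
      using G d by (intro norm_sq_combination[OF e]) auto
    also have "\<dots> = sum ?q (G (Suc n)) - sum ?q (G n)" using G by (simp add: sum_diff)
    also have "\<dots> \<le> (1/4) ^ n" using le[OF G(1,2), of "Suc n"] tail[of n] by simp
    also have "(1/4) ^ n = ((1/2) ^ n :: real)\<^sup>2" by (simp flip: power_mult add: power_one_over mult.commute[of n] power_mult)
    finally show ?thesis using d power2_le_imp_le[of "vnorm H ?d" "(1/2) ^ n"] by simp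
  qed
  hence "summable (\<lambda>n. vnorm H (vdiff H (X (Suc n)) (X n)))"
    by (intro summable_comparison_test[OF _ summable_geometric[of "1/2 :: real"]]) auto
  then obtain x where x: "x \<in> vecs H" and lim: "(\<lambda>n. vnorm H (vdiff H (X n) x)) \<longlonglongrightarrow> 0"
    using complete X by blast
  have conv: "(\<lambda>n. vinner H y (X n)) \<longlonglongrightarrow> vinner H y x" if y: "y \<in> vecs H" for y
  proof (rule LIMSEQ_if_norm_diff_le)
    show "norm (vinner H y (X n) - vinner H y x) \<le> vnorm H y * vnorm H (vdiff H (X n) x)" for n
      using Cauchy_Schwarz[OF y, of "vdiff H (X n) x" for n] X x y by simp
    show "(\<lambda>n. vnorm H y * vnorm H (vdiff H (X n) x)) \<longlonglongrightarrow> 0"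
      using tendsto_mult_right_zero[OF lim] .
  qed
  have coef: "vinner H (e j) x = a j" if j: "j \<in> J" for j
  proof -
    have Xj: "vinner H (e j) (X n) = (if j \<in> G n then a j else 0)" for n
    proof -
      have "vinner H (e j) (X n) = (\<Sum>i\<in>G n. a i * (if j = i then 1 else 0))"
        unfolding comb[OF ej[OF j]] using orthonormal_familyD(2)[OF e] G j
        by (intro sum.cong) (simp_all add: subset_iff)
      thus ?thesis using G by (simp add: mult_delta_right)
    qed
    have "norm (vinner H (e j) (X n) - a j) \<le> (1/2) ^ n" for n
    proof (cases "j \<in> G n")
      case False
      \<comment> \<open>An index outside \<open>G n\<close> belongs to the missing tail, so its
        coefficient alone is bounded by the mass of that tail.\<close>
      have "sum ?q (insert j (G n)) \<le> s" using G j by (intro le) auto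
      hence "?q j \<le> (1/4) ^ n" using False G tail[of n] by simp
      also have "(1/4) ^ n = ((1/2) ^ n :: real)\<^sup>2"
        by (simp flip: power_mult add: power_one_over mult.commute[of n] power_mult)
      finally show ?thesis using False Xj power2_le_imp_le[of "cmod (a j)" "(1/2) ^ n"] by simp
    qed (simp add: Xj)
    hence "(\<lambda>n. vinner H (e j) (X n)) \<longlonglongrightarrow> a j"
      by (rule LIMSEQ_if_norm_diff_le) (simp add: LIMSEQ_realpow_zero)
    with conv[OF ej[OF j]] show ?thesis by (rule LIMSEQ_unique)
  qed
  have "(\<lambda>n. vinner H x (X n)) \<longlonglongrightarrow> vinner H x x" by (rule conv[OF x])
  moreover have "vinner H x (X n) = of_real (sum ?q (G n))" for n
  proof -
    have "vinner H x (X n) = (\<Sum>j\<in>G n. a j * cnj (a j))"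
      unfolding comb[OF x]
    proof (intro sum.cong refl)
      fix j assume "j \<in> G n"
      hence "j \<in> J" using G(2) by blast
      thus "a j * vinner H x (e j) = a j * cnj (a j)"
        using inner_commute[OF ej x, of j] coef by simp
    qed
    thus ?thesis by (simp add: complex_norm_square[symmetric])
  qed
  ultimately have "(\<lambda>n. complex_of_real (sum ?q (G n))) \<longlonglongrightarrow> of_real ((vnorm H x)\<^sup>2)"
    using inner_self[OF x] by simp
  hence "(\<lambda>n. sum ?q (G n)) \<longlonglongrightarrow> (vnorm H x)\<^sup>2"
    by (simp only: tendsto_of_real_iff)
  moreover have "(\<lambda>n. sum ?q (G n)) \<longlonglongrightarrow> s"
  proof (rule LIMSEQ_if_norm_diff_le)
    show "norm (sum ?q (G n) - s) \<le> (1/4) ^ n" for n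
      using tail[of n] le[OF G(1,2), of n] by simp
  qed (simp add: LIMSEQ_realpow_zero)
  ultimately have "(vnorm H x)\<^sup>2 = s" by (rule LIMSEQ_unique)
  with hs coef x show ?thesis by auto
qed

text \<open>Bessel makes the coefficients of x square summable. Riesz-Fischer gives a vector with
  these coefficients whose squared norm is their sum, and the basis property forces it to be
  x.\<close>

lemma Parseval:
  assumes e: "orthonormal_family H e J" and B: "orthonormal_basis H (e ` J)" and x: "x \<in> vecs H"
  shows "((\<lambda>j. (cmod (vinner H (e j) x))\<^sup>2) has_sum (vnorm H x)\<^sup>2) J"
proof -
  obtain y where y: "y \<in> vecs H" "\<forall>j\<in>J. vinner H (e j) y = vinner H (e j) x"
    and hs: "((\<lambda>j. (cmod (vinner H (e j) x))\<^sup>2) has_sum (vnorm H y)\<^sup>2) J"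
    using Riesz_Fischer[OF e coefficients_summable[OF e x]] by blast
  have "y = x" using B y(1) x by (rule eq_if_inner_basis_eq) (use y(2) in auto)
  with hs show ?thesis by simp
qed

lemma isometry_family:
  assumes "orthonormal_family H e J" "isometry_op H H T"
  shows "orthonormal_family H (\<lambda>j. T (e j)) J"
  using assms by (auto simp: orthonormal_family_def isometry_inner isometry_mem)

text \<open>The vectors \<open>T (e j)\<close> are again orthonormal, so their inner products with x
  are square summable by Bessel. Riesz-Fischer realizes these numbers as the coefficients of y, and
  the identity extends from the basis to every z.\<close>

lemma adjoint_exists:
  assumes e: "orthonormal_family H e J" and B: "orthonormal_basis H (e ` J)"
    and T: "isometry_op H H T" and x: "x \<in> vecs H"
  shows "\<exists>y\<in>vecs H. \<forall>z\<in>vecs H. vinner H z y = vinner H (T z) x"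
proof -
  obtain y where y: "y \<in> vecs H" and c: "\<forall>j\<in>J. vinner H (e j) y = vinner H (T (e j)) x"
    using Riesz_Fischer[OF e coefficients_summable[OF isometry_family[OF e T] x]] by blast
  have "vinner H z y = vinner H (T z) x" if z: "z \<in> vecs H" for z
  proof -
    have "vinner H y b = vinner H x (T b)" if "b \<in> e ` J" for b
    proof -
      have b: "b \<in> vecs H" using that e by (auto simp: orthonormal_family_def)
      have "vinner H b y = vinner H (T b) x" using c that by auto
      thus ?thesis
        by (simp add: inner_commute[OF b y] inner_commute[OF isometry_mem[OF T b] x])
    qed
    hence "vinner H y z = vinner H x (T z)"
      using bounded_functional_eq_on_basis[OF bounded_functional_inner_isometry[OF y isometry_id]
        bounded_functional_inner_isometry[OF x T] B _ z] by blast
    thus ?thesis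
      by (simp add: inner_commute[OF y z] inner_commute[OF x isometry_mem[OF T z]])
  qed
  with y show ?thesis by blast
qed

context
  fixes e :: "'i \<Rightarrow> 'v" and J :: "'i set" and T :: "'v \<Rightarrow> 'v"
  assumes e: "orthonormal_family H e J" and B: "orthonormal_basis H (e ` J)"
    and T: "isometry_op H H T"
begin

lemma
  assumes x: "x \<in> vecs H"
  shows adjoint_mem: "adjoint_op H T x \<in> vecs H"
    and inner_adjoint: "z \<in> vecs H \<Longrightarrow> vinner H z (adjoint_op H T x) = vinner H (T z) x"
proof -
  let ?P = "\<lambda>y. y \<in> vecs H \<and> (\<forall>z\<in>vecs H. vinner H z y = vinner H (T z) x)"
  obtain y where y: "?P y" using adjoint_exists[OF e B T x] by blast
  have "?P (THE y. ?P y)"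
    by (rule theI[of ?P, OF y]) (use y in \<open>auto intro: inner_separating\<close>)
  thus "adjoint_op H T x \<in> vecs H"
    "z \<in> vecs H \<Longrightarrow> vinner H z (adjoint_op H T x) = vinner H (T z) x"
    unfolding adjoint_op_def[symmetric] by auto
qed

lemma adjoint_linear: "linear_op H H (adjoint_op H T)"
  unfolding linear_op_def
  by (auto intro!: inner_separating adjoint_mem simp: adjoint_mem inner_adjoint isometry_mem[OF T])

text \<open>This bound makes functionals that contain an adjoint bounded, so that they too can be
  compared on a basis.\<close>

lemma adjoint_contraction:
  assumes x: "x \<in> vecs H"
  shows "vnorm H (adjoint_op H T x) \<le> vnorm H x"
proof -
  let ?y = "adjoint_op H T x"
  have y: "?y \<in> vecs H" by (rule adjoint_mem[OF x])
  have "(vnorm H ?y)\<^sup>2 = cmod (vinner H ?y ?y)" using inner_self[OF y] by (simp add: norm_power)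
  also have "\<dots> = cmod (vinner H (T ?y) x)" using inner_adjoint[OF x y] by simp
  also have "\<dots> \<le> vnorm H (T ?y) * vnorm H x"
    by (intro Cauchy_Schwarz isometry_mem[OF T] x y)
  also have "vnorm H (T ?y) = vnorm H ?y" using T y by (simp add: isometry_op_def)
  finally have "vnorm H ?y * vnorm H ?y \<le> vnorm H ?y * vnorm H x" by (simp add: power2_eq_square)
  thus ?thesis using norm_nonneg[OF y] norm_nonneg[OF x]
    by (cases "vnorm H ?y = 0") (simp_all add: mult_le_cancel_left)
qed

end

end

section \<open>Operators that repeat one diagonal block\<close>

lemma vspan_singleton:
  assumes "pre_hilbert H" "e\<^sub>0 \<in> vecs H"
  shows "vspan H {e\<^sub>0} = range (\<lambda>c. vscale H c e\<^sub>0)"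
proof -
  interpret pre_hilbert H by fact
  note e0 = assms(2)
  have "x \<in> range (\<lambda>c. vscale H c e\<^sub>0)" if "x \<in> vspan H {e\<^sub>0}" for x
    using that
  proof induction
    case zero
    have "vzero H = vscale H 0 e\<^sub>0" using e0 by (intro inner_separating) simp_all
    thus ?case by blast
  next
    case (base x)
    hence "x = vscale H 1 e\<^sub>0" using e0 by (intro inner_separating) simp_all
    thus ?case by blast
  next
    case (add x y)
    then obtain c d where "x = vscale H c e\<^sub>0" "y = vscale H d e\<^sub>0" by blast
    hence "vadd H x y = vscale H (c + d) e\<^sub>0"
      using e0 by (intro inner_separating) (simp_all add: algebra_simps)
    thus ?case by blast
  next
    case (scale x d)
    then obtain c where "x = vscale H c e\<^sub>0" by blast
    hence "vscale H d x = vscale H (d * c) e\<^sub>0"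
      using e0 by (intro inner_separating) simp_all
    thus ?case by blast
  qed
  moreover have "vscale H c e\<^sub>0 \<in> vspan H {e\<^sub>0}" for c
    by (intro vspan.scale vspan.base) simp
  ultimately show ?thesis by blast
qed

text \<open>
  \<open>T k\<close> maps the whole space onto the \<open>k\<close>-th block. The families \<open>e\<^sub>0\<close> and \<open>T k (b i)\<close> are
  joined into one family over pairs; the block with number \<open>0\<close> has the dummy index \<open>undefined\<close>.
\<close>

locale repeated_block = hilbert H for H :: "'v inner_space" +
  fixes b :: "'i \<Rightarrow> 'v" and I :: "'i set" and e\<^sub>0 :: 'v and T :: "nat \<Rightarrow> 'v \<Rightarrow> 'v" and U :: "'v \<Rightarrow> 'v"
    and blocks :: "nat \<times> 'i \<Rightarrow> 'v" and J :: "(nat \<times> 'i) set"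
  defines blocks_def: "blocks \<equiv> \<lambda>(k, i). case k of 0 \<Rightarrow> e\<^sub>0 | Suc k \<Rightarrow> T k (b i)"
    and J_def: "J \<equiv> Sigma UNIV (case_nat {undefined} (\<lambda>_. I))"
  assumes family: "orthonormal_family H b I"
    and basis: "orthonormal_basis H (b ` I)"
    and block_isometry: "isometry_op H H (T k)"
    and block_family: "orthonormal_family H blocks J"
    and block_basis: "orthonormal_basis H (blocks ` J)"
    and unitary: "unitary_op H H U"
    and fixed: "U e\<^sub>0 = e\<^sub>0"
    and off_diagonal: "k \<noteq> l \<Longrightarrow> i \<in> I \<Longrightarrow> j \<in> I \<Longrightarrow> vinner H (T k (b i)) (U (T l (b j))) = 0"
    and diagonal: "i \<in> I \<Longrightarrow> j \<in> I \<Longrightarrow>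
      vinner H (T k (b i)) (U (T k (b j))) = vinner H (T 0 (b i)) (U (T 0 (b j)))"
begin

lemma block_in_J [simp]: "(0, undefined) \<in> J" "i \<in> I \<Longrightarrow> (Suc k, i) \<in> J"
  by (auto simp: J_def)

lemma J_cases:
  assumes "j \<in> J"
  obtains "j = (0, undefined)" | k i where "i \<in> I" "j = (Suc k, i)"
  using assms by (cases j; cases "fst j") (auto simp: J_def)

lemma b_mem [simp]: "i \<in> I \<Longrightarrow> b i \<in> vecs H"
  by (rule orthonormal_familyD(1)[OF family])

lemma e0_mem [simp]: "e\<^sub>0 \<in> vecs H"
  using orthonormal_familyD(1)[OF block_family block_in_J(1)] by (simp add: blocks_def)

lemma e0_normal [simp]: "vinner H e\<^sub>0 e\<^sub>0 = 1"
  using orthonormal_familyD(2)[OF block_family block_in_J(1) block_in_J(1)] by (simp add: blocks_def)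

lemma block_orthogonal:
  assumes "i \<in> I" "j \<in> I"
  shows "vinner H (T k (b i)) (T l (b j)) = (if k = l \<and> i = j then 1 else 0)"
  using orthonormal_familyD(2)[OF block_family block_in_J(2) block_in_J(2), OF assms, of k l]
  by (simp add: blocks_def)

lemma block_orthogonal_e0: "i \<in> I \<Longrightarrow> vinner H (T k (b i)) e\<^sub>0 = 0"
  using orthonormal_familyD(2)[OF block_family block_in_J(2) block_in_J(1), of i k]
  by (simp add: blocks_def)

lemma isometry_U: "isometry_op H H U"
  using unitary by (simp add: unitary_op_def)

lemmas U_mem [simp] = isometry_mem[OF isometry_U]
lemmas T_mem [simp] = isometry_mem[OF block_isometry]
lemmas adj_mem [simp] = adjoint_mem[OF family basis block_isometry]
lemmas inner_adj [simp] = inner_adjoint[OF family basis block_isometry]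

lemma isometry_linear:
  assumes "isometry_op H H S"
  shows "x \<in> vecs H \<Longrightarrow> y \<in> vecs H \<Longrightarrow> S (vadd H x y) = vadd H (S x) (S y)"
    and "x \<in> vecs H \<Longrightarrow> S (vscale H c x) = vscale H c (S x)"
    and "x \<in> vecs H \<Longrightarrow> vnorm H (S x) = vnorm H x"
  using assms by (simp_all add: isometry_op_def linear_op_def)

lemmas T_linear = isometry_linear[OF block_isometry]
lemmas U_linear = isometry_linear[OF isometry_U]

lemma adj_linear:
  "x \<in> vecs H \<Longrightarrow> y \<in> vecs H \<Longrightarrow>
    adjoint_op H (T k) (vadd H x y) = vadd H (adjoint_op H (T k) x) (adjoint_op H (T k) y)"
  "x \<in> vecs H \<Longrightarrow> adjoint_op H (T k) (vscale H c x) = vscale H c (adjoint_op H (T k) x)"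
  using adjoint_linear[OF family basis block_isometry] by (simp_all add: linear_op_def)

lemma adj_eqI:
  assumes "x \<in> vecs H" "y \<in> vecs H" "\<And>i. i \<in> I \<Longrightarrow> vinner H (T k (b i)) x = vinner H (b i) y"
  shows "adjoint_op H (T k) x = y"
  using basis adj_mem[OF assms(1)] assms(2)
  by (rule eq_if_inner_basis_eq) (use assms in auto)

lemma adj_block:
  assumes "i \<in> I"
  shows "adjoint_op H (T k) (T l (b i)) = (if k = l then b i else vzero H)"
  using assms
  by (intro adj_eqI) (auto simp: block_orthogonal orthonormal_familyD(2)[OF family])

lemma adj_e0: "adjoint_op H (T k) e\<^sub>0 = vzero H"
  by (intro adj_eqI) (simp_all add: block_orthogonal_e0)

lemma isometry_zero:
  assumes S: "isometry_op H H S"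
  shows "S (vzero H) = vzero H"
proof -
  have "vzero H = vscale H 0 (vzero H)" by (intro inner_separating) simp_all
  hence "S (vzero H) = vscale H 0 (S (vzero H))"
    using isometry_linear(2)[OF S zero_mem, of 0] by simp
  also have "\<dots> = vzero H"
    using isometry_mem[OF S zero_mem] by (intro inner_separating) simp_all
  finally show ?thesis .
qed

lemmas T_zero [simp] = isometry_zero[OF block_isometry]
lemmas U_zero [simp] = isometry_zero[OF isometry_U]

lemma isometry_U_T: "isometry_op H H (\<lambda>x. U (T k x))"
  by (rule isometry_comp[OF isometry_U block_isometry])

text \<open>T_0 times its adjoint is the projection onto the range of \<open>T 0\<close>, so this
  says that \<open>U\<close> leaves that range invariant. Tested against the block basis: e_0 is
  orthogonal to the range and fixed by the isometry \<open>U\<close>, and the other blocks do not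
  meet the image under \<open>U\<close> because off-diagonal entries vanish.\<close>

lemma block_invariant:
  assumes y: "y \<in> vecs H"
  shows "T 0 (adjoint_op H (T 0) (U (T 0 y))) = U (T 0 y)"
proof (rule eq_if_inner_basis_eq[OF block_basis])
  fix v assume "v \<in> blocks ` J"
  then obtain j where j: "j \<in> J" and v: "v = blocks j" by blast
  from j show "vinner H v (T 0 (adjoint_op H (T 0) (U (T 0 y)))) = vinner H v (U (T 0 y))"
  proof (cases rule: J_cases)
    case 1
    have "vinner H e\<^sub>0 (T 0 z) = 0" if z: "z \<in> vecs H" for z
      using inner_adj[of e\<^sub>0 z 0] z inner_commute[of "T 0 z" e\<^sub>0] by (simp add: adj_e0)
    moreover from this have "vinner H e\<^sub>0 (U (T 0 z)) = 0" if z: "z \<in> vecs H" for z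
      using isometry_inner[OF isometry_U, of e\<^sub>0 "T 0 z"] z by (simp add: fixed)
    ultimately show ?thesis using y by (simp add: v 1 blocks_def)
  next
    case (2 k i)
    have eq: "vinner H (T k (b i)) (T 0 (adjoint_op H (T 0) x)) = vinner H (T k (b i)) x"
      if "k = 0" "x \<in> vecs H" for x
      using that 2 isometry_inner[OF block_isometry] by simp
    show ?thesis
    proof (cases "k = 0")
      case True
      thus ?thesis using y eq by (simp add: v 2 blocks_def)
    next
      case False
      have "vinner H (T k (b i)) (T 0 z) = 0" if z: "z \<in> vecs H" for z
        using inner_adj[of "T k (b i)" z 0] z 2 inner_commute[of "T 0 z" "T k (b i)"] False
        by (simp add: adj_block)
      moreover have "vinner H (T k (b i)) (U (T 0 y)) = 0"
      proof -
        have f: "bounded_functional H (\<lambda>x. vinner H (T k (b i)) (U (T 0 x)))"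
          using 2 by (intro bounded_functional_inner_isometry isometry_U_T) simp
        \<comment> \<open>The zero functional, written as an inner product with the zero
          vector.\<close>
        have g: "bounded_functional H (\<lambda>x. vinner H (vzero H) x)"
          by (intro bounded_functional_inner_isometry isometry_id) simp
        have "vinner H (T k (b i)) (U (T 0 y)) = vinner H (vzero H) y"
          by (rule bounded_functional_eq_on_basis[OF f g basis _ y])
            (use 2 False in \<open>auto simp: off_diagonal\<close>)
        thus ?thesis using y by simp
      qed
      ultimately show ?thesis using y by (simp add: v 2 blocks_def)
    qed
  qed
qed (use y in simp_all)

text \<open>Moving the adjoint to the other side leaves an identity between entries, which is
  checked on the block basis: both sides vanish on e_0 and on blocks l \<noteq> k, and on block k it
  is \<open>diagonal\<close>. This yields the image of \<open>U\<close> only after projection to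
  block 0; \<open>block_invariant\<close> removes the projection.\<close>

lemma adj_intertwines:
  assumes x: "x \<in> vecs H"
  shows "T 0 (adjoint_op H (T k) (U x)) = U (T 0 (adjoint_op H (T k) x))"
proof -
  let ?R = "\<lambda>x. T 0 (adjoint_op H (T k) x)"
  have R: "linear_op H H (\<lambda>x. U (?R x))"
    by (auto simp: linear_op_def adj_linear T_linear U_linear)
  have Rn: "vnorm H (U (?R x)) \<le> vnorm H x" if "x \<in> vecs H" for x
    using that adjoint_contraction[OF family basis block_isometry that, of k]
    by (simp add: T_linear U_linear)
  have "adjoint_op H (T k) (U x) = adjoint_op H (T 0) (U (?R x))"
  proof (rule adj_eqI)
    fix i assume i: "i \<in> I"
    have f: "bounded_functional H (\<lambda>x. vinner H (T k (b i)) (U x))"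
      using i by (intro bounded_functional_inner_isometry isometry_U) simp
    have g: "bounded_functional H (\<lambda>x. vinner H (T 0 (b i)) (U (?R x)))"
      using i by (intro bounded_functional_inner R Rn) simp_all
    have "vinner H (T k (b i)) (U x) = vinner H (T 0 (b i)) (U (?R x))"
    proof (rule bounded_functional_eq_on_basis[OF f g block_basis _ x])
      fix v assume "v \<in> blocks ` J"
      then obtain j where j: "j \<in> J" and v: "v = blocks j" by blast
      from j show "vinner H (T k (b i)) (U v) = vinner H (T 0 (b i)) (U (?R v))"
      proof (cases rule: J_cases)
        case 1
        thus ?thesis using i
          by (simp add: v blocks_def fixed block_orthogonal_e0 adj_e0)
      next
        case (2 l m)
        thus ?thesis using i diagonal[of i m l]
          by (cases "k = l") (simp_all add: v blocks_def off_diagonal adj_block)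
      qed
    qed
    thus "vinner H (T k (b i)) (U x) = vinner H (b i) (adjoint_op H (T 0) (U (?R x)))"
      using i x by simp
  qed (use x in simp_all)
  thus ?thesis using block_invariant[of "adjoint_op H (T k) x"] x by simp
qed

section \<open>The model space and the unitary equivalence\<close>

abbreviation W where "W \<equiv> T 0 ` vecs H"

abbreviation K where "K \<equiv> model_space H e\<^sub>0 W"

abbreviation M where "M \<equiv> model_op H e\<^sub>0 (restrict U W)"

definition V :: "'v \<Rightarrow> nat \<Rightarrow> 'v" where
  "V x = case_nat (vscale H (vinner H e\<^sub>0 x) e\<^sub>0) (\<lambda>k. T 0 (adjoint_op H (T k) x))"

lemmas span_e0 = vspan_singleton[OF pre_hilbert_axioms e0_mem]

text \<open>\<open>subsp\<close> changes the carrier alone, so every summand has the operations of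
  \<open>H\<close>; the distinction between the first summand and the others survives only in
  membership.\<close>

lemma model_simps:
  "vadd K g h k = vadd H (g k) (h k)"
  "vscale K c h k = vscale H c (h k)"
  "vinner K g h = (\<Sum>k. vinner H (g k) (h k))"
proof -
  have eq: "vinner (case k of 0 \<Rightarrow> subsp H A | Suc k \<Rightarrow> subsp H B) = vinner H" for k A B
    by (simp add: subsp_def split: nat.split)
  show "vinner K g h = (\<Sum>k. vinner H (g k) (h k))"
    unfolding model_space_def hilbert_sum_def eq by simp
qed (simp_all add: model_space_def hilbert_sum_def subsp_def split: nat.split)

lemma model_vecs:
  "h \<in> vecs K \<longleftrightarrow> h 0 \<in> vspan H {e\<^sub>0} \<and> (\<forall>k. h (Suc k) \<in> W) \<and> summable (\<lambda>k. (vnorm H (h k))\<^sup>2)"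
proof -
  have norm: "vnorm (case k of 0 \<Rightarrow> subsp H A | Suc k \<Rightarrow> subsp H B) = vnorm H" for k A B
    by (simp add: vnorm_def subsp_def fun_eq_iff split: nat.split)
  have "(\<forall>k. h k \<in> vecs (case k of 0 \<Rightarrow> subsp H A | Suc k \<Rightarrow> subsp H B)) \<longleftrightarrow>
      h 0 \<in> A \<and> (\<forall>k. h (Suc k) \<in> B)" for A B
    by (simp add: subsp_def split: nat.splits) (metis not0_implies_Suc)
  thus ?thesis
    unfolding model_space_def hilbert_sum_def norm by simp
qed

lemma model_mem:
  assumes "h \<in> vecs K"
  shows "h k \<in> vecs H"
proof (cases k)
  case (Suc l)
  have "h (Suc l) \<in> W" using assms by (simp add: model_vecs)
  thus ?thesis by (auto simp: Suc)
qed (use assms in \<open>auto simp: model_vecs span_e0\<close>)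

lemma model_inner_self:
  assumes h: "\<And>k. h k \<in> vecs H" and s: "(\<lambda>k. (vnorm H (h k))\<^sup>2) sums s"
  shows "vnorm K h = sqrt s"
proof -
  have "(\<lambda>k. vinner H (h k) (h k)) sums complex_of_real s"
    using s h by (simp only: inner_self sums_of_real_iff)
  hence "vinner K h h = complex_of_real s" by (simp add: model_simps sums_iff)
  thus ?thesis by (simp add: vnorm_def)
qed

lemma V_simps [simp]:
  "V x 0 = vscale H (vinner H e\<^sub>0 x) e\<^sub>0"
  "V x (Suc k) = T 0 (adjoint_op H (T k) x)"
  by (simp_all add: V_def)

lemma V_mem: "x \<in> vecs H \<Longrightarrow> V x k \<in> vecs H"
  by (cases k) simp_all

text \<open>Parseval for the block basis is a sum over pairs. Summed first inside block k, it gives,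
  by Parseval for \<open>b\<close>, the squared norm of the k-th entry, since \<open>T 0\<close>
  preserves norms.\<close>

lemma V_norm:
  assumes x: "x \<in> vecs H"
  shows "(\<lambda>k. (vnorm H (V x k))\<^sup>2) sums (vnorm H x)\<^sup>2"
proof (rule has_sum_imp_sums, rule has_sum_SigmaD)
  show "((\<lambda>j. (cmod (vinner H (blocks j) x))\<^sup>2) has_sum (vnorm H x)\<^sup>2) (Sigma UNIV (case_nat {undefined} (\<lambda>_. I)))"
    using Parseval[OF block_family block_basis x] by (simp add: J_def)
  fix k
  show "((\<lambda>i. (cmod (vinner H (blocks (k, i)) x))\<^sup>2) has_sum (vnorm H (V x k))\<^sup>2)
      (case k of 0 \<Rightarrow> {undefined} | Suc k \<Rightarrow> I)"
  proof (cases k)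
    case 0
    have "(vnorm H (V x 0))\<^sup>2 = (cmod (vinner H e\<^sub>0 x))\<^sup>2"
      using x norm_sq[of e\<^sub>0] by (simp add: norm_scale power_mult_distrib)
    thus ?thesis using has_sum_finite[of "{undefined}" "\<lambda>i. (cmod (vinner H (blocks (k, i)) x))\<^sup>2"]
      by (simp add: 0 blocks_def)
  next
    case (Suc l)
    have "((\<lambda>i. (cmod (vinner H (b i) (adjoint_op H (T l) x)))\<^sup>2) has_sum
        (vnorm H (adjoint_op H (T l) x))\<^sup>2) I"
      using x by (intro Parseval[OF family basis]) simp
    also have "?this \<longleftrightarrow> ((\<lambda>i. (cmod (vinner H (T l (b i)) x))\<^sup>2) has_sum
        (vnorm H (adjoint_op H (T l) x))\<^sup>2) I"
      using x by (intro has_sum_cong) simp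
    finally show ?thesis using x by (simp add: Suc blocks_def T_linear)
  qed
qed

lemma V_in_model: "x \<in> vecs H \<Longrightarrow> V x \<in> vecs K"
  using V_norm[of x] by (auto simp: model_vecs span_e0 sums_iff)

lemma V_isometry: "isometry_op H K V"
proof -
  have "vnorm K (V x) = vnorm H x" if "x \<in> vecs H" for x
    using model_inner_self[OF V_mem[OF that] V_norm[OF that]] that by simp
  moreover have "V (vadd H x y) = vadd K (V x) (V y)" if "x \<in> vecs H" "y \<in> vecs H" for x y
  proof
    fix k
    show "V (vadd H x y) k = vadd K (V x) (V y) k"
      using that
      by (cases k; simp add: model_simps T_linear adj_linear)
        (rule inner_separating; simp add: algebra_simps)
  qed
  moreover have "V (vscale H c x) = vscale K c (V x)" if "x \<in> vecs H" for c x
  proof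
    fix k
    show "V (vscale H c x) k = vscale K c (V x) k"
      using that
      by (cases k; simp add: model_simps T_linear adj_linear)
        (rule inner_separating; simp add: algebra_simps)
  qed
  ultimately show ?thesis by (simp add: isometry_op_def linear_op_def V_in_model)
qed

text \<open>Each entry in W_0 is \<open>T 0 (y k)\<close>, and the coefficients of
  \<open>y k\<close> with respect to \<open>b\<close> are the coefficients that a preimage must have
  in block k. Their squares add up to the squared norms of the entries of h, so Riesz-Fischer
  applies to all blocks at once.\<close>

lemma V_surj:
  assumes h: "h \<in> vecs K"
  shows "h \<in> V ` vecs H"
proof -
  have hk: "h k \<in> vecs H" for k by (rule model_mem[OF h])
  obtain c where c: "h 0 = vscale H c e\<^sub>0" using h by (auto simp: model_vecs span_e0)
  have "\<exists>y\<in>vecs H. h (Suc k) = T 0 y" for k using h by (auto simp: model_vecs)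
  then obtain y where y: "\<And>k. y k \<in> vecs H" "\<And>k. h (Suc k) = T 0 (y k)" by metis
  define a where "a = (\<lambda>(k, i). case k of 0 \<Rightarrow> c | Suc k \<Rightarrow> vinner H (b i) (y k))"
  have "(\<lambda>j. (cmod (a j))\<^sup>2) summable_on J"
    unfolding J_def
  proof (rule summable_on_SigmaI)
    fix k
    show "((\<lambda>i. (cmod (a (k, i)))\<^sup>2) has_sum (vnorm H (h k))\<^sup>2)
        (case k of 0 \<Rightarrow> {undefined} | Suc k \<Rightarrow> I)"
    proof (cases k)
      case 0
      have "(vnorm H (h 0))\<^sup>2 = (cmod c)\<^sup>2"
        using norm_sq[of e\<^sub>0] by (simp add: c norm_scale power_mult_distrib)
      thus ?thesis using has_sum_finite[of "{undefined}" "\<lambda>i. (cmod (a (k, i)))\<^sup>2"]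
        by (simp add: 0 a_def)
    next
      case (Suc l)
      show ?thesis using Parseval[OF family basis y(1)[of l]] y by (simp add: Suc a_def T_linear)
    qed
  next
    show "(\<lambda>k. (vnorm H (h k))\<^sup>2) summable_on UNIV"
      using h by (simp add: model_vecs summable_on_UNIV_nonneg_real_iff)
  qed simp
  then obtain x where x: "x \<in> vecs H" and coef: "\<And>j. j \<in> J \<Longrightarrow> vinner H (blocks j) x = a j"
    using Riesz_Fischer[OF block_family] by blast
  have "V x k = h k" for k
  proof (cases k)
    case 0
    show ?thesis using coef[OF block_in_J(1)] by (simp add: 0 blocks_def a_def c)
  next
    case (Suc l)
    have "adjoint_op H (T l) x = y l"
      using coef[OF block_in_J(2), of _ l] by (intro adj_eqI x y) (simp add: blocks_def a_def)
    thus ?thesis by (simp add: Suc y)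
  qed
  hence "V x = h" by (rule ext)
  with x show ?thesis by blast
qed

text \<open>On the summands that make up the model space the projection acts as the identity and the
  restriction as \<open>U\<close>.\<close>

lemma M_simps [simp]:
  "h 0 \<in> vspan H {e\<^sub>0} \<Longrightarrow> M h 0 = h 0"
  "h (Suc k) \<in> W \<Longrightarrow> M h (Suc k) = U (h (Suc k))"
proof -
  show "M h 0 = h 0" if h: "h 0 \<in> vspan H {e\<^sub>0}"
  proof -
    have mem: "vspan H {e\<^sub>0} \<subseteq> vecs H" by (auto simp: span_e0)
    have "orth_proj H (vspan H {e\<^sub>0}) (h 0) = h 0"
      unfolding orth_proj_def
    proof (rule the_equality)
      show "h 0 \<in> vspan H {e\<^sub>0} \<and> (\<forall>w\<in>vspan H {e\<^sub>0}. vinner H w (vdiff H (h 0) (h 0)) = 0)"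
        using h mem by (simp add: subset_iff)
      fix y assume y: "y \<in> vspan H {e\<^sub>0} \<and> (\<forall>w\<in>vspan H {e\<^sub>0}. vinner H w (vdiff H (h 0) y) = 0)"
      obtain c d where c: "h 0 = vscale H c e\<^sub>0" and d: "y = vscale H d e\<^sub>0"
        using h y by (auto simp: span_e0)
      have "vinner H e\<^sub>0 (vdiff H (h 0) y) = 0" using y by (blast intro: vspan.base)
      thus "y = h 0" by (simp add: c d)
    qed
    thus ?thesis by (simp add: model_op_def sum_op_def)
  qed
qed (simp add: model_op_def sum_op_def)

lemma W_closed:
  shows W_add: "x \<in> W \<Longrightarrow> y \<in> W \<Longrightarrow> vadd H x y \<in> W"
    and W_scale: "x \<in> W \<Longrightarrow> vscale H c x \<in> W"
    and W_invariant: "x \<in> W \<Longrightarrow> U x \<in> W"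
proof -
  show "vadd H x y \<in> W" if xy: "x \<in> W" "y \<in> W"
  proof -
    from xy obtain u v where "u \<in> vecs H" "x = T 0 u" "v \<in> vecs H" "y = T 0 v" by blast
    thus ?thesis by (intro image_eqI[of _ _ "vadd H u v"]) (simp_all add: T_linear)
  qed
  show "vscale H c x \<in> W" if x: "x \<in> W"
  proof -
    from x obtain u where "u \<in> vecs H" "x = T 0 u" by blast
    thus ?thesis by (intro image_eqI[of _ _ "vscale H c u"]) (simp_all add: T_linear)
  qed
  show "U x \<in> W" if x: "x \<in> W"
  proof -
    from x obtain u where "u \<in> vecs H" "x = T 0 u" by blast
    thus ?thesis
      by (intro image_eqI[of _ _ "adjoint_op H (T 0) (U (T 0 u))"]) (simp_all add: block_invariant)
  qed
qed

lemma M_linear: "linear_op K K M"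
proof -
  have split: "f = g" if "f 0 = g 0" "\<And>k. f (Suc k) = g (Suc k)" for f g :: "nat \<Rightarrow> 'v"
    using that by (intro ext) (metis not0_implies_Suc)
  have mem: "M h \<in> vecs K" if h: "h \<in> vecs K" for h
  proof -
    have "vnorm H (M h k) = vnorm H (h k)" for k
      using h by (cases k) (simp_all add: model_vecs U_linear model_mem[OF h])
    thus ?thesis using h by (simp add: model_vecs W_invariant)
  qed
  have "M (vadd K g h) = vadd K (M g) (M h)" if g: "g \<in> vecs K" and h: "h \<in> vecs K" for g h
  proof (rule split)
    have "vadd K g h 0 \<in> vspan H {e\<^sub>0}"
      using g h by (simp add: model_simps model_vecs vspan.add)
    thus "M (vadd K g h) 0 = vadd K (M g) (M h) 0"
      using g h by (simp add: model_simps model_vecs)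
    fix k
    have "vadd K g h (Suc k) \<in> W"
      using g h by (simp add: model_simps model_vecs W_add)
    thus "M (vadd K g h) (Suc k) = vadd K (M g) (M h) (Suc k)"
      using g h model_mem[OF g, of "Suc k"] model_mem[OF h, of "Suc k"]
      by (simp add: model_simps model_vecs U_linear)
  qed
  moreover have "M (vscale K c h) = vscale K c (M h)" if h: "h \<in> vecs K" for c h
  proof (rule split)
    have "vscale K c h 0 \<in> vspan H {e\<^sub>0}"
      using h by (simp add: model_simps model_vecs vspan.scale)
    thus "M (vscale K c h) 0 = vscale K c (M h) 0"
      using h by (simp add: model_simps model_vecs)
    fix k
    have "vscale K c h (Suc k) \<in> W"
      using h by (simp add: model_simps model_vecs W_scale)
    thus "M (vscale K c h) (Suc k) = vscale K c (M h) (Suc k)"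
      using h model_mem[OF h, of "Suc k"]
      by (simp add: model_simps model_vecs U_linear)
  qed
  ultimately show ?thesis using mem by (simp add: linear_op_def)
qed

lemma V_intertwines:
  assumes x: "x \<in> vecs H"
  shows "V (U x) = M (V x)"
proof
  fix k
  show "V (U x) k = M (V x) k"
  proof (cases k)
    case 0
    have "vinner H e\<^sub>0 (U x) = vinner H e\<^sub>0 x"
      using isometry_inner[OF isometry_U e0_mem x] by (simp add: fixed)
    thus ?thesis by (simp add: 0 span_e0)
  qed (use x in \<open>simp add: adj_intertwines\<close>)
qed

theorem unitarily_equivalent_model: "unitarily_equivalent H U K M"
proof -
  have "V ` vecs H = vecs K" using V_surj V_in_model by blast
  thus ?thesis
    unfolding unitarily_equivalent_def unitary_op_def
    using V_isometry M_linear V_intertwines isometry_U by (auto simp: isometry_op_def[of H H])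
qed

end

section \<open>The Hilbert space of square integrable functions\<close>

lemma sq_integrable_diff:
  assumes "f \<in> sq_integrable M" "g \<in> sq_integrable M"
  shows "(\<lambda>x. f x - g x) \<in> sq_integrable M"
  using sq_integrable_add[OF assms(1) sq_integrable_scale[OF assms(2), of "-1"]] by simp

lemma L2_class_mem: "f \<in> sq_integrable M \<Longrightarrow> l2_class M f \<in> vecs (L2 M)"
  by (simp add: L2_def l2_class_def quotientI)

lemma L2_cases:
  assumes "F \<in> vecs (L2 M)"
  obtains f where "f \<in> sq_integrable M" "F = l2_class M f"
  using assms by (auto simp: L2_def l2_class_def elim: quotientE)

lemma zero_sq_integrable: "(\<lambda>_. 0) \<in> sq_integrable M"
  by (simp add: sq_integrable_def)

lemma borel_measurable_cnj [measurable (raw)]: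
  assumes "f \<in> borel_measurable M"
  shows "(\<lambda>x. cnj (f x)) \<in> borel_measurable M"
  by (intro borel_measurable_continuous_on[OF _ assms] continuous_intros)

lemma integrable_cnj_mult:
  assumes "f \<in> sq_integrable M" "g \<in> sq_integrable M"
  shows "integrable M (\<lambda>x. cnj (f x) * g x)"
proof (rule Bochner_Integration.integrable_bound)
  show "integrable M (\<lambda>x. (cmod (f x))\<^sup>2 + (cmod (g x))\<^sup>2)"
    using assms by (simp add: sq_integrable_def)
  have [measurable]: "f \<in> borel_measurable M" "g \<in> borel_measurable M"
    using assms by (simp_all add: sq_integrable_def)
  show "(\<lambda>x. cnj (f x) * g x) \<in> borel_measurable M" by measurable
  have "a * b \<le> a\<^sup>2 + b\<^sup>2" for a b :: real
    using sum_squares_bound[of a b] zero_le_power2[of a] zero_le_power2[of b] by linarith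
  thus "AE x in M. norm (cnj (f x) * g x) \<le> norm ((cmod (f x))\<^sup>2 + (cmod (g x))\<^sup>2)"
    by (simp add: norm_mult)
qed

lemma L2_diff_class:
  assumes "f \<in> sq_integrable M" "g \<in> sq_integrable M"
  shows "vdiff (L2 M) (l2_class M f) (l2_class M g) = l2_class M (\<lambda>x. f x - g x)"
  using L2_add_class[OF assms(1) sq_integrable_scale[OF assms(2), of "-1"]]
  by (simp add: vdiff_def L2_scale_class assms)

lemma L2_inner_self_class:
  assumes "f \<in> sq_integrable M"
  shows "vinner (L2 M) (l2_class M f) (l2_class M f) = of_real (\<integral>x. (cmod (f x))\<^sup>2 \<partial>M)"
proof -
  have "vinner (L2 M) (l2_class M f) (l2_class M f) = (\<integral>x. of_real ((cmod (f x))\<^sup>2) \<partial>M)"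
    unfolding L2_inner_class[OF assms assms]
    by (intro Bochner_Integration.integral_cong refl) (simp add: complex_norm_square[symmetric] mult.commute)
  thus ?thesis by (simp only: integral_complex_of_real)
qed

lemma L2_norm_class:
  "f \<in> sq_integrable M \<Longrightarrow> vnorm (L2 M) (l2_class M f) = sqrt (\<integral>x. (cmod (f x))\<^sup>2 \<partial>M)"
  by (simp add: vnorm_def L2_inner_self_class)

lemma L2_norm_class_nn:
  assumes "f \<in> sq_integrable M"
  shows "(\<integral>\<^sup>+x. ennreal ((cmod (f x))\<^sup>2) \<partial>M) = ennreal ((vnorm (L2 M) (l2_class M f))\<^sup>2)"
  using assms by (subst nn_integral_eq_integral) (simp_all add: L2_norm_class sq_integrable_def)

interpretation L2: pre_hilbert "L2 M" for M :: "'a measure"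
proof
  show "vzero (L2 M) \<in> vecs (L2 M)"
    using L2_class_mem[OF zero_sq_integrable] by (simp add: L2_def)
  fix F assume "F \<in> vecs (L2 M)"
  then obtain f where f: "f \<in> sq_integrable M" "F = l2_class M f" by (rule L2_cases)
  show "vscale (L2 M) c F \<in> vecs (L2 M)" for c
    by (simp add: f L2_scale_class L2_class_mem sq_integrable_scale)
  have "vinner (L2 M) F (vzero (L2 M)) = vinner (L2 M) (l2_class M f) (l2_class M (\<lambda>_. 0))"
    by (simp add: L2_def f)
  thus "vinner (L2 M) F (vzero (L2 M)) = 0"
    by (simp add: L2_inner_class f zero_sq_integrable)
  show "0 \<le> Re (vinner (L2 M) F F)"
    by (simp add: f L2_inner_self_class)
  fix G assume "G \<in> vecs (L2 M)"
  then obtain g where g: "g \<in> sq_integrable M" "G = l2_class M g" by (rule L2_cases)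
  show "vadd (L2 M) F G \<in> vecs (L2 M)"
    by (simp add: f g L2_add_class L2_class_mem sq_integrable_add)
  show "vinner (L2 M) F (vscale (L2 M) c G) = c * vinner (L2 M) F G" for c
    by (simp add: f g L2_scale_class L2_inner_class sq_integrable_scale mult.left_commute
        flip: integral_mult_right_zero)
  have "vinner (L2 M) G F = (\<integral>x. cnj (cnj (f x) * g x) \<partial>M)"
    by (simp add: f g L2_inner_class mult.commute del: Bochner_Integration.integral_cnj)
  thus "vinner (L2 M) G F = cnj (vinner (L2 M) F G)"
    by (simp only: f g L2_inner_class Bochner_Integration.integral_cnj)
  show "F = G" if eq: "\<And>Z. Z \<in> vecs (L2 M) \<Longrightarrow> vinner (L2 M) Z F = vinner (L2 M) Z G"
  proof -
    \<comment> \<open>Testing the hypothesis with the class of f - g shows that the integral of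
      \<bar>f - g\<bar>^2 is zero.\<close>
    let ?d = "\<lambda>x. f x - g x"
    have d: "?d \<in> sq_integrable M" by (rule sq_integrable_diff[OF f(1) g(1)])
    have "(\<integral>x. cnj (?d x) * f x \<partial>M) = (\<integral>x. cnj (?d x) * g x \<partial>M)"
      using eq[OF L2_class_mem[OF d]] by (simp add: f g d L2_inner_class)
    moreover have "(\<integral>x. cnj (?d x) * ?d x \<partial>M) = (\<integral>x. cnj (?d x) * f x \<partial>M) - (\<integral>x. cnj (?d x) * g x \<partial>M)"
      using integrable_cnj_mult[OF d f(1)] integrable_cnj_mult[OF d g(1)]
      by (simp only: right_diff_distrib Bochner_Integration.integral_diff)
    ultimately have "(\<integral>x. (cmod (?d x))\<^sup>2 \<partial>M) = 0"
      using L2_inner_self_class[OF d] by (simp add: L2_inner_class d)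
    hence "AE x in M. (cmod (?d x))\<^sup>2 = 0"
      using d by (subst (asm) integral_nonneg_eq_0_iff_AE) (auto simp: sq_integrable_def)
    hence "AE x in M. f x = g x" by simp
    thus ?thesis unfolding f g using f(1) g(1) by (intro l2_class_eqI) (simp add: ae_rel_def)
  qed
  fix Z assume "Z \<in> vecs (L2 M)"
  then obtain z where z: "z \<in> sq_integrable M" "Z = l2_class M z" by (rule L2_cases)
  show "vinner (L2 M) Z (vadd (L2 M) F G) = vinner (L2 M) Z F + vinner (L2 M) Z G"
    using integrable_cnj_mult[OF z(1) f(1)] integrable_cnj_mult[OF z(1) g(1)]
    by (simp add: f g z L2_add_class L2_inner_class sq_integrable_add distrib_left)
qed

text \<open>
  With \<open>a n = \<parallel>f (n + 1) - f n\<parallel>\<close> and \<open>w n = a n + (1/2)\<^sup>n\<close>, the integral of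
  \<open>\<Sum>n. |f (n + 1) - f n|\<^sup>2 / w n\<close> is at most \<open>\<Sum>n. a n\<close>, and \<open>d \<le> d\<^sup>2 / w + w\<close>.
\<close>

lemma AE_convergent_if_L2_norms_summable:
  fixes f :: "nat \<Rightarrow> 'a \<Rightarrow> complex"
  assumes f: "\<And>n. f n \<in> sq_integrable M"
    and sm: "summable (\<lambda>n. vnorm (L2 M) (l2_class M (\<lambda>x. f (Suc n) x - f n x)))"
  shows "AE x in M. convergent (\<lambda>n. f n x)"
proof -
  define a where "a n = vnorm (L2 M) (l2_class M (\<lambda>x. f (Suc n) x - f n x))" for n
  define w where "w n = a n + (1/2) ^ n" for n
  define d where "d n x = cmod (f (Suc n) x - f n x)" for n x
  have fm [measurable]: "f n \<in> borel_measurable M" for n using f by (simp add: sq_integrable_def)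
  have [measurable]: "d n \<in> borel_measurable M" for n unfolding d_def by measurable
  have diff: "(\<lambda>x. f (Suc n) x - f n x) \<in> sq_integrable M" for n by (intro sq_integrable_diff f)
  have a0: "0 \<le> a n" for n unfolding a_def by (intro L2.norm_nonneg L2_class_mem diff)
  have w0: "0 < w n" for n unfolding w_def using a0[of n] by (intro add_nonneg_pos) simp_all
  have sa: "summable a" using sm by (simp add: a_def[abs_def])
  have sw: "summable w" unfolding w_def by (intro summable_add sa summable_geometric) simp
  have "(\<integral>\<^sup>+x. (\<Sum>n. ennreal ((d n x)\<^sup>2 / w n)) \<partial>M) = (\<Sum>n. \<integral>\<^sup>+x. ennreal ((d n x)\<^sup>2 / w n) \<partial>M)"
    by (rule nn_integral_suminf) measurable
  also have "\<dots> \<le> (\<Sum>n. ennreal (a n))"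
  proof (intro suminf_le summableI)
    fix n
    have "(\<integral>\<^sup>+x. ennreal ((d n x)\<^sup>2 / w n) \<partial>M) = (\<integral>\<^sup>+x. ennreal (1 / w n) * ennreal ((d n x)\<^sup>2) \<partial>M)"
      using w0[of n] by (intro nn_integral_cong) (simp add: ennreal_mult[symmetric])
    also have "\<dots> = ennreal (1 / w n) * ennreal ((a n)\<^sup>2)"
      unfolding a_def L2_norm_class_nn[OF diff, symmetric] d_def by (rule nn_integral_cmult) measurable
    also have "\<dots> = ennreal ((a n)\<^sup>2 / w n)"
      using w0[of n] by (simp add: ennreal_mult[symmetric])
    also have "(a n)\<^sup>2 / w n \<le> a n"
    proof -
      have "a n * a n \<le> a n * w n" using a0[of n] by (intro mult_left_mono) (simp_all add: w_def)
      thus ?thesis using w0[of n] by (simp add: divide_le_eq power2_eq_square)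
    qed
    finally show "(\<integral>\<^sup>+x. ennreal ((d n x)\<^sup>2 / w n) \<partial>M) \<le> ennreal (a n)"
      by (simp add: ennreal_leI)
  qed
  also have "\<dots> < \<infinity>"
    using suminf_ennreal_eq[OF a0 summable_sums[OF sa]] by simp
  finally have "AE x in M. (\<Sum>n. ennreal ((d n x)\<^sup>2 / w n)) \<noteq> \<infinity>"
    by (intro nn_integral_noteq_infinite) auto
  thus ?thesis
  proof eventually_elim
    fix x assume fin: "(\<Sum>n. ennreal ((d n x)\<^sup>2 / w n)) \<noteq> \<infinity>"
    have "summable (\<lambda>n. (d n x)\<^sup>2 / w n)"
      using fin w0 by (intro summable_suminf_not_top) (simp_all add: less_imp_le)
    hence s: "summable (\<lambda>n. (d n x)\<^sup>2 / w n + w n)" by (intro summable_add sw)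
    have "norm (d n x) \<le> (d n x)\<^sup>2 / w n + w n" for n
    proof (cases "d n x \<le> w n")
      case True
      have "0 \<le> (d n x)\<^sup>2 / w n" using w0[of n] by simp
      with True show ?thesis by (simp add: d_def)
    next
      case False
      have "d n x * w n \<le> d n x * d n x" using False by (intro mult_left_mono) (simp_all add: d_def)
      hence "d n x \<le> (d n x)\<^sup>2 / w n" using w0[of n] by (simp add: le_divide_eq power2_eq_square)
      thus ?thesis using w0[of n] by (simp add: d_def)
    qed
    hence "summable (\<lambda>n. d n x)" by (intro summable_comparison_test[OF _ s]) auto
    hence "summable (\<lambda>n. f (Suc n) x - f n x)" unfolding d_def by (rule summable_norm_cancel)
    hence "convergent (\<lambda>n. \<Sum>i<n. f (Suc i) x - f i x)" by (simp add: summable_iff_convergent)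
    hence "convergent (\<lambda>n. f n x - f 0 x)" by (simp only: sum_lessThan_telescope[of "\<lambda>i. f i x"])
    thus "convergent (\<lambda>n. f n x)"
      using convergent_add[OF _ convergent_const[of "f 0 x"]] by fastforce
  qed
qed

text \<open>The almost everywhere limit of representatives is the candidate; Fatou's lemma turns
  bounds between members of the sequence into bounds to the limit.\<close>

interpretation L2: hilbert "L2 M" for M :: "'a measure"
proof
  fix X :: "nat \<Rightarrow> ('a \<Rightarrow> complex) set"
  assume X: "\<And>n. X n \<in> vecs (L2 M)"
    and sm: "summable (\<lambda>n. vnorm (L2 M) (vdiff (L2 M) (X (Suc n)) (X n)))"
  define a where "a n = vnorm (L2 M) (vdiff (L2 M) (X (Suc n)) (X n))" for n
  have "\<exists>f. f \<in> sq_integrable M \<and> X n = l2_class M f" for n using X[of n] by (rule L2_cases) blast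
  then obtain f where f: "\<And>n. f n \<in> sq_integrable M" and Xf: "\<And>n. X n = l2_class M (f n)" by metis
  have fm [measurable]: "f n \<in> borel_measurable M" for n using f by (simp add: sq_integrable_def)
  define g where "g x = lim (\<lambda>n. f n x)" for x
  have gm [measurable]: "g \<in> borel_measurable M"
    unfolding g_def by (rule borel_measurable_lim_metric) measurable
  have "AE x in M. convergent (\<lambda>n. f n x)"
    using sm by (intro AE_convergent_if_L2_norms_summable f) (simp add: Xf L2_diff_class f)
  hence conv: "AE x in M. (\<lambda>n. f n x) \<longlonglongrightarrow> g x"
    by eventually_elim (simp add: g_def convergent_LIMSEQ_iff)
  \<comment> \<open>The remainder of the summable increments bounds, by the triangle inequality, the
    distance of \<open>X n\<close> to all later members.\<close>
  define tail where "tail n = suminf a - sum a {..<n}" for n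
  have a0: "0 \<le> a n" for n using X by (simp add: a_def)
  have sa: "summable a" using sm by (simp add: a_def[abs_def])
  have tail0: "0 \<le> tail n" for n
    using sum_le_suminf[OF sa, of "{..<n}"] a0 by (simp add: tail_def)
  have dist: "vnorm (L2 M) (vdiff (L2 M) (X m) (X n)) \<le> tail n" if "n \<le> m" for m n
  proof -
    have "vnorm (L2 M) (vdiff (L2 M) (X m) (X n)) \<le> sum a {..<m} - sum a {..<n}"
      using that
    proof (induction m rule: dec_induct)
      case base
      have "vdiff (L2 M) (X n) (X n) = vzero (L2 M)" using X by (intro L2.inner_separating[where M = M]) simp_all
      thus ?case by simp
    next
      case (step m)
      thus ?case using L2.norm_diff_triangle[of "X (Suc m)" M "X m" "X n"] X by (simp add: a_def)
    qed
    also have "\<dots> \<le> tail n"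
      using sum_le_suminf[OF sa, of "{..<m}"] a0 by (simp add: tail_def)
    finally show ?thesis .
  qed
  have le: "(\<integral>\<^sup>+x. ennreal ((cmod (f n x - g x))\<^sup>2) \<partial>M) \<le> ennreal ((tail n)\<^sup>2)" for n
  proof -
    have "(\<integral>\<^sup>+x. ennreal ((cmod (f n x - g x))\<^sup>2) \<partial>M)
        = (\<integral>\<^sup>+x. liminf (\<lambda>m. ennreal ((cmod (f m x - f n x))\<^sup>2)) \<partial>M)"
    proof (rule nn_integral_cong_AE)
      show "AE x in M. ennreal ((cmod (f n x - g x))\<^sup>2) = liminf (\<lambda>m. ennreal ((cmod (f m x - f n x))\<^sup>2))"
        using conv
      proof eventually_elim
        fix x assume "(\<lambda>m. f m x) \<longlonglongrightarrow> g x"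
        hence "(\<lambda>m. ennreal ((cmod (f m x - f n x))\<^sup>2)) \<longlonglongrightarrow> ennreal ((cmod (g x - f n x))\<^sup>2)"
          by (intro tendsto_intros)
        hence "liminf (\<lambda>m. ennreal ((cmod (f m x - f n x))\<^sup>2)) = ennreal ((cmod (g x - f n x))\<^sup>2)"
          by (rule lim_imp_Liminf[OF trivial_limit_sequentially])
        thus "ennreal ((cmod (f n x - g x))\<^sup>2) = liminf (\<lambda>m. ennreal ((cmod (f m x - f n x))\<^sup>2))"
          by (simp only: norm_minus_commute[of "f n x" "g x"])
      qed
    qed
    also have "\<dots> \<le> liminf (\<lambda>m. \<integral>\<^sup>+x. ennreal ((cmod (f m x - f n x))\<^sup>2) \<partial>M)"
      by (rule nn_integral_liminf) measurable
    also have "\<dots> \<le> liminf (\<lambda>m. ennreal ((tail n)\<^sup>2))"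
    proof (rule Liminf_mono, rule eventually_mono[OF eventually_ge_at_top[of n]])
      fix m assume m: "n \<le> m"
      have "vnorm (L2 M) (l2_class M (\<lambda>x. f m x - f n x)) \<le> tail n"
        using dist[OF m] by (simp add: Xf L2_diff_class f)
      hence "(vnorm (L2 M) (l2_class M (\<lambda>x. f m x - f n x)))\<^sup>2 \<le> (tail n)\<^sup>2"
        by (rule power_mono) (intro L2.norm_nonneg L2_class_mem sq_integrable_diff f)
      thus "(\<integral>\<^sup>+x. ennreal ((cmod (f m x - f n x))\<^sup>2) \<partial>M) \<le> ennreal ((tail n)\<^sup>2)"
        by (simp add: L2_norm_class_nn sq_integrable_diff f ennreal_leI)
    qed
    also have "\<dots> = ennreal ((tail n)\<^sup>2)" by (simp add: Liminf_const)
    finally show ?thesis .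
  qed
  have diff: "(\<lambda>x. f n x - g x) \<in> sq_integrable M" for n
  proof -
    have "integrable M (\<lambda>x. (cmod (f n x - g x))\<^sup>2)"
      using le_less_trans[OF le[of n] ennreal_less_top]
      by (intro integrableI_bounded) auto
    thus ?thesis by (simp add: sq_integrable_def)
  qed
  \<comment> \<open>Square integrability of the limit is inherited from g = f_0 - (f_0 - g).\<close>
  have g: "g \<in> sq_integrable M" using sq_integrable_diff[OF f[of 0] diff[of 0]] by simp
  show "\<exists>x\<in>vecs (L2 M). (\<lambda>n. vnorm (L2 M) (vdiff (L2 M) (X n) x)) \<longlonglongrightarrow> 0"
  proof (rule bexI[OF _ L2_class_mem[OF g]], rule tendsto_sandwich)
    show "\<forall>\<^sub>F n in sequentially. 0 \<le> vnorm (L2 M) (vdiff (L2 M) (X n) (l2_class M g))"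
      using X L2_class_mem[OF g] by simp
    show "\<forall>\<^sub>F n in sequentially. vnorm (L2 M) (vdiff (L2 M) (X n) (l2_class M g)) \<le> tail n"
    proof (intro always_eventually allI)
      fix n
      have "(vnorm (L2 M) (vdiff (L2 M) (X n) (l2_class M g)))\<^sup>2 \<le> (tail n)\<^sup>2"
        using le[of n] tail0[of n] by (simp add: Xf L2_diff_class f g L2_norm_class_nn diff)
      thus "vnorm (L2 M) (vdiff (L2 M) (X n) (l2_class M g)) \<le> tail n"
        by (rule power2_le_imp_le[OF _ tail0])
    qed
    show "tail \<longlonglongrightarrow> 0"
      unfolding tail_def using summable_LIMSEQ[OF sa] by (intro tendsto_eq_intros) auto
  qed simp
qed

section \<open>Fourier transforms of Bernoulli convolutions\<close>

lemma ennreal_half_add: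
  assumes "0 \<le> x" "0 \<le> y"
  shows "ennreal (1/2 * (x + y)) = ennreal (1/2) * (ennreal x + ennreal y)"
  unfolding ennreal_plus[OF assms, symmetric] by (rule ennreal_mult) (use assms in simp_all)

text \<open>Self-similarity is given on Borel sets, that is, for indicators; it passes to sums,
  multiples and increasing limits, hence to all nonnegative Borel functions.\<close>

lemma bernoulli_nn_integral:
  fixes f :: "real \<Rightarrow> ennreal"
  assumes \<mu>: "bernoulli_convolution r \<mu>" and f: "f \<in> borel_measurable borel"
  shows "(\<integral>\<^sup>+x. f x \<partial>\<mu>) =
    ennreal (1/2) * ((\<integral>\<^sup>+x. f (tau_plus r x) \<partial>\<mu>) + (\<integral>\<^sup>+x. f (tau_minus r x) \<partial>\<mu>))"
proof -
  interpret prob_space \<mu> using \<mu> by (simp add: bernoulli_convolution_def)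
  have sets [measurable_cong, simp]: "sets \<mu> = sets borel" using \<mu> by (simp add: bernoulli_convolution_def)
  have [measurable]: "tau_plus r \<in> borel_measurable borel" "tau_minus r \<in> borel_measurable borel"
    unfolding tau_plus_def tau_minus_def by measurable
  let ?p = "distr \<mu> borel (tau_plus r)" and ?m = "distr \<mu> borel (tau_minus r)"
  interpret p: prob_space ?p by (rule prob_space_distr) measurable
  interpret m: prob_space ?m by (rule prob_space_distr) measurable
  have "(\<integral>\<^sup>+x. f x \<partial>\<mu>) = ennreal (1/2) * ((\<integral>\<^sup>+x. f x \<partial>?p) + (\<integral>\<^sup>+x. f x \<partial>?m))"
    using f
  proof (induction rule: borel_measurable_induct)
    case (cong f g)
    thus ?case by simp
  next
    case (set A)
    have "measure \<mu> A = 1/2 * (measure ?p A + measure ?m A)"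
      using \<mu> set by (simp add: bernoulli_convolution_def)
    hence "ennreal (measure \<mu> A) = ennreal (1/2) * (ennreal (measure ?p A) + ennreal (measure ?m A))"
      by (simp only: ennreal_half_add measure_nonneg)
    thus ?case
      using set by (simp add: emeasure_eq_measure p.emeasure_eq_measure m.emeasure_eq_measure)
  next
    case (mult u c)
    thus ?case by (simp add: nn_integral_cmult distrib_left mult_ac)
  next
    case (add u v)
    thus ?case by (simp add: nn_integral_add distrib_left add_ac)
  next
    case (seq U)
    have inc: "incseq U" by fact
    have SUP: "(\<integral>\<^sup>+x. (SUP i. U i) x \<partial>N) = (SUP i. \<integral>\<^sup>+x. U i x \<partial>N)" if "sets N = sets borel" for N
    proof -
      have "(\<integral>\<^sup>+x. (SUP i. U i x) \<partial>N) = (SUP i. \<integral>\<^sup>+x. U i x \<partial>N)"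
      proof (rule nn_integral_monotone_convergence_SUP[OF inc])
        show "U i \<in> borel_measurable N" for i
          using seq.hyps(1)[of i] by (simp cong: measurable_cong_sets add: measurable_cong_sets[OF that refl])
      qed
      thus ?thesis by (simp add: image_comp)
    qed
    have mono: "incseq (\<lambda>i. \<integral>\<^sup>+x. U i x \<partial>N)" for N
      using inc by (auto simp: incseq_def le_fun_def intro!: nn_integral_mono)
    show ?case
      unfolding SUP[OF sets] SUP[OF sets_distr] seq.IH
      by (subst ennreal_SUP_add[OF mono mono, symmetric]) (rule SUP_mult_left_ennreal[symmetric])
  qed
  thus ?thesis using f by (simp add: nn_integral_distr)
qed

text \<open>The bound makes f + 1 nonnegative, and the added constant cancels because \<mu> has
  total mass 1.\<close>

lemma bernoulli_integral:
  fixes f :: "real \<Rightarrow> real"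
  assumes \<mu>: "bernoulli_convolution r \<mu>" and f: "f \<in> borel_measurable borel"
    and bound: "\<And>x. \<bar>f x\<bar> \<le> 1"
  shows "(\<integral>x. f x \<partial>\<mu>) = ((\<integral>x. f (tau_plus r x) \<partial>\<mu>) + (\<integral>x. f (tau_minus r x) \<partial>\<mu>)) / 2"
proof -
  interpret prob_space \<mu> using \<mu> by (simp add: bernoulli_convolution_def)
  have [measurable_cong, simp]: "sets \<mu> = sets borel" using \<mu> by (simp add: bernoulli_convolution_def)
  note [measurable] = f
  have [measurable]: "tau_plus r \<in> borel_measurable borel" "tau_minus r \<in> borel_measurable borel"
    unfolding tau_plus_def tau_minus_def by measurable
  have nonneg: "0 \<le> f x + 1" for x using bound[of x] by linarith
  have int: "integrable \<mu> (\<lambda>x. f (h x))" if [measurable]: "h \<in> borel_measurable borel" for h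
    by (rule integrable_const_bound[of _ 1]) (use bound in auto)
  have nn: "(\<integral>\<^sup>+x. ennreal (f (h x) + 1) \<partial>\<mu>) = ennreal ((\<integral>x. f (h x) \<partial>\<mu>) + 1)"
    if h [measurable]: "h \<in> borel_measurable borel" for h
    using int[OF h] nonneg by (subst nn_integral_eq_integral) (simp_all add: prob_space)
  have ge: "0 \<le> (\<integral>x. f (h x) \<partial>\<mu>) + 1" if h [measurable]: "h \<in> borel_measurable borel" for h
  proof -
    have "0 \<le> (\<integral>x. f (h x) + 1 \<partial>\<mu>)" using nonneg by (intro integral_nonneg_AE) simp
    thus ?thesis using int[OF h] by (simp add: prob_space)
  qed
  have "ennreal ((\<integral>x. f x \<partial>\<mu>) + 1) =
      ennreal (1/2) * (ennreal ((\<integral>x. f (tau_plus r x) \<partial>\<mu>) + 1) + ennreal ((\<integral>x. f (tau_minus r x) \<partial>\<mu>) + 1))"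
    using bernoulli_nn_integral[OF \<mu>, of "\<lambda>x. ennreal (f x + 1)"] nn[of "\<lambda>x. x"]
    by (simp add: nn)
  also have "\<dots> = ennreal (1/2 * (((\<integral>x. f (tau_plus r x) \<partial>\<mu>) + 1) + ((\<integral>x. f (tau_minus r x) \<partial>\<mu>) + 1)))"
    by (intro ennreal_half_add[symmetric] ge) measurable
  finally have "(\<integral>x. f x \<partial>\<mu>) + 1 =
      1/2 * (((\<integral>x. f (tau_plus r x) \<partial>\<mu>) + 1) + ((\<integral>x. f (tau_minus r x) \<partial>\<mu>) + 1))"
    using ge[of "\<lambda>x. x"] ge[of "tau_plus r"] ge[of "tau_minus r"] by (subst (asm) ennreal_inj) simp_all
  thus ?thesis by (simp add: field_simps)
qed

text \<open>Averaging over the two maps replaces the argument t x by t r x + t r and t r x - t r. In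
  the addition formulas the terms with sin (t r) cancel, which leaves the common factor cos (t r)
  for both the real and the imaginary part.\<close>

lemma char_bernoulli:
  assumes \<mu>: "bernoulli_convolution r \<mu>"
  shows "char \<mu> t = complex_of_real (cos (t * r)) * char \<mu> (t * r)"
proof -
  interpret prob_space \<mu> using \<mu> by (simp add: bernoulli_convolution_def)
  have [measurable_cong, simp]: "sets \<mu> = sets borel" using \<mu> by (simp add: bernoulli_convolution_def)
  have int: "integrable \<mu> (\<lambda>x. iexp (s * x))" for s
    by (rule integrable_const_bound[of _ 1]) (auto simp: norm_exp_i_times simp del: of_real_mult)
  have intc: "integrable \<mu> (\<lambda>x. cos (s * x + u))" and ints: "integrable \<mu> (\<lambda>x. sin (s * x + u))" for s u
    by (rule integrable_const_bound[of _ 1]; simp)+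
  have Re: "Re (char \<mu> s) = (\<integral>x. cos (s * x) \<partial>\<mu>)" for s
    unfolding char_def by (subst integral_Re[OF int, symmetric]) (simp add: Re_exp)
  have Im: "Im (char \<mu> s) = (\<integral>x. sin (s * x) \<partial>\<mu>)" for s
    unfolding char_def by (subst integral_Im[OF int, symmetric]) (simp add: Im_exp)
  have "(\<integral>x. cos (t * x) \<partial>\<mu>) = (\<integral>x. (cos (t * r * x + t * r) + cos (t * r * x + - (t * r))) / 2 \<partial>\<mu>)"
    using bernoulli_integral[OF \<mu>, of "\<lambda>x. cos (t * x)"] intc[of "t * r" "t * r"] intc[of "t * r" "- (t * r)"]
    by (simp add: tau_plus_def tau_minus_def algebra_simps)
  also have "\<dots> = (\<integral>x. cos (t * r) * cos (t * r * x) \<partial>\<mu>)"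
    by (intro Bochner_Integration.integral_cong refl) (simp only: cos_add, simp add: field_simps)
  finally have c: "(\<integral>x. cos (t * x) \<partial>\<mu>) = cos (t * r) * (\<integral>x. cos (t * r * x) \<partial>\<mu>)" by simp
  have "(\<integral>x. sin (t * x) \<partial>\<mu>) = (\<integral>x. (sin (t * r * x + t * r) + sin (t * r * x + - (t * r))) / 2 \<partial>\<mu>)"
    using bernoulli_integral[OF \<mu>, of "\<lambda>x. sin (t * x)"] ints[of "t * r" "t * r"] ints[of "t * r" "- (t * r)"]
    by (simp add: tau_plus_def tau_minus_def algebra_simps)
  also have "\<dots> = (\<integral>x. cos (t * r) * sin (t * r * x) \<partial>\<mu>)"
    by (intro Bochner_Integration.integral_cong refl) (simp only: sin_add, simp add: field_simps)
  finally have s: "(\<integral>x. sin (t * x) \<partial>\<mu>) = cos (t * r) * (\<integral>x. sin (t * r * x) \<partial>\<mu>)" by simp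
  show ?thesis by (rule complex_eqI) (simp_all add: Re Im c s)
qed

section \<open>The matrix of the scaling operator\<close>

text \<open>The exponent of the vector with the given index in the block basis: the index (k + 1,
  \<gamma>) stands for T_k e_\<gamma>, and number 0 ignores its second component.\<close>

definition frequency :: "nat \<Rightarrow> nat \<times> real \<Rightarrow> real" where
  "frequency n = (\<lambda>(i, \<gamma>). case i of 0 \<Rightarrow> 0 | Suc k \<Rightarrow> (2 * real n) ^ k * (real n / 2 + 2 * real n * \<gamma>))"

context
  fixes n :: nat and \<mu> :: "real measure"
  assumes n: "n \<ge> 1" and \<mu>: "bernoulli_convolution (1 / (2 * real n)) \<mu>"
begin

text \<open>\<open>char\<close> integrates exp (i t x), so F(s) is
  \<open>char \<mu> (2 * pi * s)\<close>; hence the factor 2 pi in all arguments from here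
  on.\<close>

lemma char_step: "char \<mu> (2 * pi * (2 * real n * s)) = complex_of_real (cos (2 * pi * s)) * char \<mu> (2 * pi * s)"
proof -
  have "2 * pi * (2 * real n * s) * (1 / (2 * real n)) = 2 * pi * s" using n by simp
  thus ?thesis using char_bernoulli[OF \<mu>, of "2 * pi * (2 * real n * s)"] by (simp only:)
qed

text \<open>For k = 0 the argument is 2n times m/4, and the factor is the cosine of m pi/2. Each
  further factor 2n only multiplies this zero by another cosine.\<close>

lemma char_odd_zero:
  assumes m: "odd m"
  shows "char \<mu> (2 * pi * ((2 * real n) ^ k * (real n / 2) * of_int m)) = 0"
proof (induction k)
  case 0
  have "cos (2 * pi * (of_int m / 4)) = cos (of_int m * (pi / 2))" by (simp add: field_simps)
  also have "\<dots> = 0" using m cos_zero_iff_int by blast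
  finally show ?case using char_step[of "of_int m / 4"] by (simp add: field_simps)
next
  case (Suc k)
  thus ?case using char_step[of "(2 * real n) ^ k * (real n / 2) * of_int m"]
    by (simp add: mult.assoc)
qed

lemma char_scale:
  fixes m :: int
  shows "char \<mu> (2 * pi * ((2 * real n) ^ k * (real n * of_int m))) = char \<mu> (2 * pi * (real n * of_int m))"
proof (induction k)
  case (Suc k)
  have "cos (2 * pi * ((2 * real n) ^ k * (real n * of_int m))) = cos (2 * pi * of_int ((2 * int n) ^ k * (int n * m)))"
    by simp
  also have "\<dots> = 1" by (rule cos_int_2pin)
  finally show ?case using Suc char_step[of "(2 * real n) ^ k * (real n * of_int m)"]
    by (simp add: mult.assoc)
qed simp

lemma Gam_odd_form:
  assumes "\<gamma> \<in> Gam n"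
  obtains m :: int where "real n / 2 + 2 * real n * \<gamma> = real n / 2 * of_int (1 + 2 * m)"
proof -
  obtain N where "\<gamma> = real n / 2 * real N" using assms by (rule Gam_multiple)
  hence "real n / 2 + 2 * real n * \<gamma> = real n / 2 * of_int (1 + 2 * (int n * int N))"
    by (simp add: algebra_simps)
  thus ?thesis by (rule that)
qed

lemma Gam_part_odd:
  assumes "x \<in> Gam_part n k"
  obtains m :: int where "odd m" "x = (2 * real n) ^ k * (real n / 2) * of_int m"
proof -
  obtain \<gamma> where "\<gamma> \<in> Gam n" and x: "x = (2 * real n) ^ k * (real n / 2 + 2 * real n * \<gamma>)"
    using assms unfolding Gam_part_eq[OF n] by blast
  then obtain m :: int where "real n / 2 + 2 * real n * \<gamma> = real n / 2 * of_int (1 + 2 * m)"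
    by (elim Gam_odd_form)
  hence "x = (2 * real n) ^ k * (real n / 2) * of_int (1 + 2 * m)"
    unfolding x by (simp only: mult.assoc)
  thus ?thesis by (rule that[rotated]) simp
qed

text \<open>One surplus factor 2n supplies the 2: relative to the smaller scale, anything at the
  larger scale is an even multiple, so adding it to an odd multiple leaves an odd one.\<close>

lemma scaled_odd_even:
  assumes kl: "k < l"
  shows "(2 * real n) ^ l * (real n / 2) * of_int a
    = (2 * real n) ^ k * (real n / 2) * of_int (2 * (int n * (2 * int n) ^ (l - Suc k) * a))"
proof -
  obtain d where d: "l = Suc (k + d)" using less_imp_Suc_add[OF kl] by blast
  have e: "l - Suc k = d" unfolding d by simp
  show ?thesis unfolding e unfolding d by (simp add: power_add)
qed

text \<open>The smaller of the two scales decides the parity of the difference; the frequency 0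
  counts as even at every scale.\<close>

lemma char_different_parts_zero:
  assumes p: "odd p" and q: "odd q" and ij: "i \<noteq> j"
    and x: "x \<in> Gam_block n i" and y: "y \<in> Gam_block n j"
  shows "char \<mu> (2 * pi * (of_int p * x - of_int q * y)) = 0"
proof -
  have block_odd: "\<exists>m. odd m \<and> of_int p * x = (2 * real n) ^ k * (real n / 2) * of_int m"
    if "x \<in> Gam_part n k" "odd p" for x k p
  proof -
    obtain m where "odd m" "x = (2 * real n) ^ k * (real n / 2) * of_int m"
      using \<open>x \<in> Gam_part n k\<close> by (rule Gam_part_odd)
    thus ?thesis using that by (intro exI[of _ "p * m"]) simp
  qed
  show ?thesis
  proof (cases i)
    case 0
    then obtain l where "j = Suc l" using ij by (cases j) auto
    then obtain b where "odd b" and b: "of_int q * y = (2 * real n) ^ l * (real n / 2) * of_int b"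
      using block_odd[of y l q] y q by (auto simp: Gam_block_def)
    moreover have "x = 0" using x 0 by (simp add: Gam_block_def)
    ultimately have "of_int p * x - of_int q * y = (2 * real n) ^ l * (real n / 2) * of_int (- b)"
      unfolding b by simp
    moreover have "odd (- b)" using \<open>odd b\<close> by simp
    ultimately show ?thesis by (simp only: char_odd_zero not_False_eq_True)
  next
    case (Suc k)
    then obtain a where a: "odd a" "of_int p * x = (2 * real n) ^ k * (real n / 2) * of_int a"
      using block_odd[of x k p] x p by (auto simp: Gam_block_def)
    show ?thesis
    proof (cases j)
      case 0
      hence "of_int p * x - of_int q * y = (2 * real n) ^ k * (real n / 2) * of_int a"
        using y unfolding a(2) by (simp add: Gam_block_def)
      thus ?thesis using char_odd_zero[OF a(1), of k] by (simp only:)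
    next
      case j: (Suc l)
      then obtain b where b: "odd b" "of_int q * y = (2 * real n) ^ l * (real n / 2) * of_int b"
        using block_odd[of y l q] y q by (auto simp: Gam_block_def)
      show ?thesis
      proof (cases "k < l")
        case True
        define c where "c = int n * (2 * int n) ^ (l - Suc k) * b"
        have "of_int p * x - of_int q * y = (2 * real n) ^ k * (real n / 2) * of_int (a - 2 * c)"
          unfolding a(2) b(2) scaled_odd_even[OF True] c_def by (simp only: of_int_diff right_diff_distrib)
        moreover have "odd (a - 2 * c)" using a by simp
        ultimately show ?thesis by (simp only: char_odd_zero not_False_eq_True)
      next
        case False
        hence lk: "l < k" using ij Suc j by simp
        define c where "c = int n * (2 * int n) ^ (k - Suc l) * a"
        have "of_int p * x - of_int q * y = (2 * real n) ^ l * (real n / 2) * of_int (2 * c - b)"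
          unfolding a(2) b(2) scaled_odd_even[OF lk] c_def by (simp only: of_int_diff right_diff_distrib)
        moreover have "odd (2 * c - b)" using b by simp
        ultimately show ?thesis by (simp only: char_odd_zero not_False_eq_True)
      qed
    qed
  qed
qed

lemma char_same_part:
  assumes p: "odd p" and \<xi>: "\<xi> \<in> Gam n" and \<gamma>: "\<gamma> \<in> Gam n"
  shows "char \<mu> (2 * pi * (of_int p * ((2 * real n) ^ k * (real n / 2 + 2 * real n * \<gamma>))
        - (2 * real n) ^ k * (real n / 2 + 2 * real n * \<xi>)))
    = char \<mu> (2 * pi * (of_int p * (real n / 2 + 2 * real n * \<gamma>) - (real n / 2 + 2 * real n * \<xi>)))"
proof -
  obtain a where a: "real n / 2 + 2 * real n * \<xi> = real n / 2 * of_int (1 + 2 * a)"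
    using \<xi> by (rule Gam_odd_form)
  obtain b where b: "real n / 2 + 2 * real n * \<gamma> = real n / 2 * of_int (1 + 2 * b)"
    using \<gamma> by (rule Gam_odd_form)
  obtain q where q: "p = 2 * q + 1" using p by (rule oddE)
  \<comment> \<open>Since p is odd, both terms are odd multiples of n/2; their difference is an even
    multiple, that is, an integer multiple of n.\<close>
  have eq: "of_int p * (real n / 2 * of_int (1 + 2 * b)) - real n / 2 * of_int (1 + 2 * a)
      = real n * of_int (q + b + 2 * q * b - a)"
    unfolding q by (simp add: field_simps)
  have "of_int p * ((2 * real n) ^ k * (real n / 2 * of_int (1 + 2 * b))) - (2 * real n) ^ k * (real n / 2 * of_int (1 + 2 * a))
      = (2 * real n) ^ k * (of_int p * (real n / 2 * of_int (1 + 2 * b)) - real n / 2 * of_int (1 + 2 * a))"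
    by (simp only: right_diff_distrib mult.left_commute)
  thus ?thesis unfolding a b by (simp only: eq char_scale)
qed

text \<open>Descent on digits. If the lowest digits of x and y agree, they cancel in y - x, and
  \<open>char_step\<close> reduces the claim to the remaining digits. If they differ, y - x is an
  odd multiple of n/2.\<close>

lemma char_Gam_diff_zero:
  assumes "x \<in> Gam n" "y \<in> Gam n" "x \<noteq> y"
  shows "char \<mu> (2 * pi * (y - x)) = 0"
proof -
  obtain N M where "x = real n / 2 * real N" "y = real n / 2 * real M"
    using assms Gam_multiple by metis
  with assms show ?thesis
  proof (induction "N + M" arbitrary: N M x y rule: less_induct)
    case less
    obtain d x' where d: "d \<in> {0, real n / 2}" and x': "x' \<in> Gam n" "x = d + 2 * real n * x'"
      using less.prems(1) by (rule Gam_cases)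
    obtain e y' where e: "e \<in> {0, real n / 2}" and y': "y' \<in> Gam n" "y = e + 2 * real n * y'"
      using less.prems(2) by (rule Gam_cases)
    obtain N' where N': "x' = real n / 2 * real N'" using x'(1) by (rule Gam_multiple)
    obtain M' where M': "y' = real n / 2 * real M'" using y'(1) by (rule Gam_multiple)
    show ?case
    proof (cases "d = e")
      case True
      have neq: "x' \<noteq> y'" using less.prems(3) x' y' True by auto
      \<comment> \<open>Removing the lowest digit at least halves the multiplier of n/2, because n
        \<ge> 1. As x' and y' differ, their multipliers are not both zero, so the sum of the
        multipliers drops strictly.\<close>
      have half: "2 * B \<le> A" if "real n / 2 * real A = c + 2 * real n * (real n / 2 * real B)" "0 \<le> c" for A B c
      proof -
        have "real n / 2 * (2 * real n * real B) \<le> real n / 2 * real A" using that by simp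
        hence "2 * real n * real B \<le> real A" by (rule mult_left_le_imp_le) (use n in simp)
        moreover have "2 * real B * 1 \<le> 2 * real B * real n" using n by (intro mult_left_mono) simp_all
        ultimately have "real (2 * B) \<le> real A" by (simp add: mult_ac)
        thus ?thesis by (simp only: of_nat_le_iff)
      qed
      have "2 * N' \<le> N" using d x' N' less.prems(4) by (intro half[of N d]) auto
      moreover have "2 * M' \<le> M" using e y' M' less.prems(5) by (intro half[of M e]) auto
      moreover have "N' + M' \<noteq> 0" using neq N' M' by auto
      ultimately have "N' + M' < N + M" by linarith
      from less.hyps[OF this x'(1) y'(1) neq N' M'] show ?thesis
        using char_step[of "y' - x'"] x' y' True by (simp add: right_diff_distrib)
    next
      case False
      define c where "c = int n * (int M' - int N')"
      have "y - x = (2 * real n) ^ 0 * (real n / 2) * of_int (1 + 2 * c)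
          \<or> y - x = (2 * real n) ^ 0 * (real n / 2) * of_int (2 * c - 1)"
        using False d e x' y' N' M' by (auto simp: c_def algebra_simps)
      moreover have "odd (1 + 2 * c)" "odd (2 * c - 1)" by simp_all
      ultimately show ?thesis by (elim disjE) (simp_all only: char_odd_zero not_False_eq_True)
    qed
  qed
qed

section \<open>Exponentials and their enumeration by blocks\<close>

lemma expo_inner: "vinner (L2 \<mu>) (expo \<mu> s) (expo \<mu> t) = char \<mu> (2 * pi * (t - s))"
proof -
  interpret prob_space \<mu> using \<mu> by (simp add: bernoulli_convolution_def)
  have [measurable_cong]: "sets \<mu> = sets borel" using \<mu> by (simp add: bernoulli_convolution_def)
  have expo: "exp (2 * of_real pi * \<i> * of_real t * of_real x) = iexp (2 * pi * t * x)" for t x :: real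
    by (simp add: mult_ac)
  have sq: "(\<lambda>x. iexp (2 * pi * t * x)) \<in> sq_integrable \<mu>" for t
    by (simp add: sq_integrable_def norm_exp_i_times del: of_real_mult)
  have "cnj (iexp (2 * pi * s * x)) * iexp (2 * pi * t * x) = iexp (2 * pi * (t - s) * x)" for x
    by (simp add: exp_cnj algebra_simps flip: exp_add)
  thus ?thesis unfolding expo_def expo char_def by (simp only: L2_inner_class[OF sq sq])
qed

lemma expo_mem: "expo \<mu> t \<in> vecs (L2 \<mu>)"
proof -
  interpret prob_space \<mu> using \<mu> by (simp add: bernoulli_convolution_def)
  have [measurable_cong]: "sets \<mu> = sets borel" using \<mu> by (simp add: bernoulli_convolution_def)
  have "exp (2 * of_real pi * \<i> * of_real t * of_real x) = iexp (2 * pi * t * x)" for x :: real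
    by (simp add: mult_ac)
  hence "(\<lambda>x. exp (2 * of_real pi * \<i> * of_real t * of_real x)) \<in> sq_integrable \<mu>"
    by (simp add: sq_integrable_def norm_exp_i_times del: of_real_mult)
  thus ?thesis unfolding expo_def by (rule L2_class_mem)
qed

lemma expo_family: "orthonormal_family (L2 \<mu>) (expo \<mu>) (Gam n)"
proof -
  interpret prob_space \<mu> using \<mu> by (simp add: bernoulli_convolution_def)
  have "char \<mu> 0 = 1" by (simp add: char_def prob_space)
  thus ?thesis by (simp add: orthonormal_family_def expo_mem expo_inner char_Gam_diff_zero)
qed

lemma Gam_scaled_mem:
  assumes "\<gamma> \<in> Gam n"
  shows "(2 * real n) ^ k * (real n / 2 + 2 * real n * \<gamma>) \<in> Gam_block n (Suc k)"
  unfolding Gam_block_def nat.case Gam_part_eq[OF n] by (rule imageI[OF assms])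

lemma Gam_block_subset: "x \<in> Gam_block n i \<Longrightarrow> x \<in> Gam n"
  using Gam_blocks_cover[OF n] by blast

lemma frequency_image_block:
  "(\<lambda>\<gamma>. frequency n (i, \<gamma>)) ` case_nat {undefined} (\<lambda>_. Gam n) i = Gam_block n i"
  by (cases i) (simp_all add: frequency_def Gam_block_def Gam_part_eq[OF n])

lemma frequency_image:
  "frequency n ` Sigma UNIV (case_nat {undefined} (\<lambda>_. Gam n)) = Gam n"
proof -
  have "frequency n ` Sigma UNIV A = (\<Union>i. (\<lambda>\<gamma>. frequency n (i, \<gamma>)) ` A i)" for A :: "nat \<Rightarrow> real set"
    by force
  thus ?thesis by (simp only: frequency_image_block Gam_blocks_cover[OF n])
qed

text \<open>Disjointness of the blocks recovers the block number. Inside a block the frequency is an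
  affine function of \<gamma> with nonzero slope, and block 0 has a single index.\<close>

lemma frequency_inj: "inj_on (frequency n) (Sigma UNIV (case_nat {undefined} (\<lambda>_. Gam n)))"
proof (rule inj_onI, elim SigmaE)
  fix x y i \<xi> j \<gamma>
  assume \<xi>: "\<xi> \<in> case_nat {undefined} (\<lambda>_. Gam n) i" and \<gamma>: "\<gamma> \<in> case_nat {undefined} (\<lambda>_. Gam n) j"
    and eq: "frequency n x = frequency n y" and xy: "x = (i, \<xi>)" "y = (j, \<gamma>)"
  have "frequency n (i, \<xi>) \<in> Gam_block n i" "frequency n (j, \<gamma>) \<in> Gam_block n j"
    using frequency_image_block[of i] frequency_image_block[of j] \<xi> \<gamma> by blast+
  hence "i = j"
    using eq Gam_blocks_disjoint[of n] unfolding xy disjoint_family_on_def by (metis UNIV_I disjoint_iff)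
  hence ji: "j = i" by simp
  show "x = y"
    using \<xi> \<gamma> eq n unfolding xy ji by (cases i) (simp_all add: frequency_def)
qed

end

section \<open>Matrix entries of the scaling operator and its block basis\<close>

theorem theorem4p8:
  fixes n :: nat and p :: int and \<mu> :: "real measure"
    and U S0 S1 :: "(real \<Rightarrow> complex) set \<Rightarrow> (real \<Rightarrow> complex) set"
  assumes "n \<ge> 1"
    and "odd p"
    and "bernoulli_convolution (1 / (2 * real n)) \<mu>"
    and "orthonormal_basis (L2 \<mu>) {expo \<mu> \<gamma> | \<gamma>. \<gamma> \<in> Gam n}"
    and "orthonormal_basis (L2 \<mu>) {expo \<mu> (of_int p * \<gamma>) | \<gamma>. \<gamma> \<in> Gam n}"
    and "unitary_op (L2 \<mu>) (L2 \<mu>) U"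
    and "\<And>\<gamma>. \<gamma> \<in> Gam n \<Longrightarrow> U (expo \<mu> \<gamma>) = expo \<mu> (of_int p * \<gamma>)"
    and "isometry_op (L2 \<mu>) (L2 \<mu>) S0"
    and "\<And>\<gamma>. \<gamma> \<in> Gam n \<Longrightarrow> S0 (expo \<mu> \<gamma>) = expo \<mu> (2 * real n * \<gamma>)"
    and "isometry_op (L2 \<mu>) (L2 \<mu>) S1"
    and "\<And>\<gamma>. \<gamma> \<in> Gam n \<Longrightarrow> S1 (expo \<mu> \<gamma>) = expo \<mu> (real n / 2 + 2 * real n * \<gamma>)"
  shows "op_matrix (L2 \<mu>) (expo \<mu>) U 0 0 = 1
    \<and> (\<forall>i j. i \<noteq> j \<longrightarrow> (\<forall>\<xi>\<in>Gam_block n i. \<forall>\<gamma>\<in>Gam_block n j.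
          op_matrix (L2 \<mu>) (expo \<mu>) U \<xi> \<gamma> = 0))
    \<and> (\<forall>k. \<forall>\<xi>\<in>Gam n. \<forall>\<gamma>\<in>Gam n.
          op_matrix (L2 \<mu>) (expo \<mu>) U
            ((2 * real n) ^ k * (real n / 2 + 2 * real n * \<xi>))
            ((2 * real n) ^ k * (real n / 2 + 2 * real n * \<gamma>))
          = op_matrix (subsp (L2 \<mu>) (W_space (L2 \<mu>) S0 S1 0)) (expo \<mu>)
              (restrict U (W_space (L2 \<mu>) S0 S1 0))
              (real n / 2 + 2 * real n * \<xi>)
              (real n / 2 + 2 * real n * \<gamma>))
    \<and> unitarily_equivalent (L2 \<mu>) U
        (model_space (L2 \<mu>) (expo \<mu> 0) (W_space (L2 \<mu>) S0 S1 0))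
        (model_op (L2 \<mu>) (expo \<mu> 0) (restrict U (W_space (L2 \<mu>) S0 S1 0)))"
proof -
  note n = assms(1) and p = assms(2) and \<mu> = assms(3) and U = assms(6) and Ue = assms(7)
    and S0 = assms(8) and S0e = assms(9) and S1 = assms(10) and S1e = assms(11)
  note inner = expo_inner[OF n \<mu>] and mem = expo_mem[OF n \<mu>] and family = expo_family[OF n \<mu>]
  let ?q = "\<lambda>k \<gamma>. (2 * real n) ^ k * (real n / 2 + 2 * real n * \<gamma>)"
  let ?e = "expo \<mu>" and ?H = "L2 \<mu>"
  let ?W = "W_space ?H S0 S1 0"
  let ?J = "Sigma UNIV (case_nat {undefined} (\<lambda>_. Gam n)) :: (nat \<times> real) set"
  have image: "{?e \<gamma> | \<gamma>. \<gamma> \<in> Gam n} = ?e ` Gam n" by blast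
  have basis: "orthonormal_basis ?H (?e ` Gam n)" using assms(4) by (simp only: image)
  have matrix: "vinner ?H (?e \<xi>) (U (?e \<gamma>)) = char \<mu> (2 * pi * (of_int p * \<gamma> - \<xi>))"
    if "\<gamma> \<in> Gam n" for \<xi> \<gamma>
    by (simp only: Ue[OF that] inner)
  have corner: "vinner ?H (?e 0) (U (?e 0)) = 1"
    using orthonormal_familyD(2)[OF family zero_in_Gam zero_in_Gam] Ue[OF zero_in_Gam] by simp
  have off: "vinner ?H (?e \<xi>) (U (?e \<gamma>)) = 0"
    if ij: "i \<noteq> j" and \<xi>: "\<xi> \<in> Gam_block n i" and \<gamma>: "\<gamma> \<in> Gam_block n j" for i j \<xi> \<gamma>
  proof -
    \<comment> \<open>An entry is F at p \<gamma> - 1 \<xi>, so the odd coefficients are p and 1,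
      with the column frequency in first place.\<close>
    have "char \<mu> (2 * pi * (of_int p * \<gamma> - of_int 1 * \<xi>)) = 0"
      by (rule char_different_parts_zero[OF n \<mu> p _ ij[symmetric] \<gamma> \<xi>]) simp
    thus ?thesis by (simp add: matrix Gam_block_subset[OF n \<mu> \<gamma>])
  qed
  have q_mem: "?q k \<gamma> \<in> Gam_block n (Suc k)" if "\<gamma> \<in> Gam n" for k \<gamma>
    by (rule Gam_scaled_mem[OF n \<mu> that])
  have q_Gam: "?q k \<gamma> \<in> Gam n" if "\<gamma> \<in> Gam n" for k \<gamma>
    by (rule Gam_block_subset[OF n \<mu> q_mem[OF that]])
  have diag: "vinner ?H (?e (?q k \<xi>)) (U (?e (?q k \<gamma>))) = vinner ?H (?e (?q 0 \<xi>)) (U (?e (?q 0 \<gamma>)))"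
    if "\<xi> \<in> Gam n" "\<gamma> \<in> Gam n" for k \<xi> \<gamma>
    unfolding matrix[OF q_Gam[OF that(2)]] using char_same_part[OF n \<mu> p that, of k] by simp
  define T where "T = (\<lambda>k x. (S0 ^^ k) (S1 x))"
  have Te: "T k (?e \<gamma>) = ?e (?q k \<gamma>)" if "\<gamma> \<in> Gam n" for k \<gamma>
  proof (induction k)
    case 0
    show ?case using S1e[OF that] by (simp add: T_def)
  next
    case (Suc k)
    have "T (Suc k) (?e \<gamma>) = S0 (T k (?e \<gamma>))" by (simp add: T_def)
    thus ?case using S0e[OF q_Gam[OF that, of k]] by (simp add: Suc mult.assoc)
  qed
  have T: "isometry_op ?H ?H (T k)" for k
    unfolding T_def by (rule L2.isometry_comp[OF L2.isometry_funpow[OF S0] S1])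
  have W: "?W = T 0 ` vecs ?H" by (simp add: W_space_def T_def)
  have blocks: "(case j of (k, \<gamma>) \<Rightarrow> case k of 0 \<Rightarrow> ?e 0 | Suc k \<Rightarrow> T k (?e \<gamma>)) = ?e (frequency n j)"
    if "j \<in> ?J" for j
    using that by (auto simp: frequency_def Te split: nat.splits)
  let ?blocks = "\<lambda>(k, \<gamma>). case k of 0 \<Rightarrow> ?e 0 | Suc k \<Rightarrow> T k (?e \<gamma>)"
  \<comment> \<open>The block vectors are the exponentials in another enumeration, so the basis
    property is the one assumed for E(\<Gamma>).\<close>
  have "?blocks ` ?J = ?e ` frequency n ` ?J"
    unfolding image_image by (intro image_cong refl blocks)
  hence block_basis: "orthonormal_basis ?H (?blocks ` ?J)"
    using basis by (simp only: frequency_image[OF n \<mu>])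
  have block_family: "orthonormal_family ?H ?blocks ?J"
    by (rule orthonormal_family_reindex[OF family frequency_inj[OF n \<mu>]
          equalityD1[OF frequency_image[OF n \<mu>]] blocks])
  have "repeated_block ?H ?e (Gam n) (?e 0) T U"
  proof
    show "orthonormal_family ?H ?e (Gam n)" by (rule family)
    show "orthonormal_basis ?H (?e ` Gam n)" by (rule basis)
    show "isometry_op ?H ?H (T k)" for k by (rule T)
    show "orthonormal_family ?H ?blocks ?J" by (rule block_family)
    show "orthonormal_basis ?H (?blocks ` ?J)" by (rule block_basis)
    show "unitary_op ?H ?H U" by (rule U)
    show "U (?e 0) = ?e 0" using Ue[OF zero_in_Gam] by simp
    show "vinner ?H (T k (?e \<xi>)) (U (T l (?e \<gamma>))) = 0"
      if "k \<noteq> l" "\<xi> \<in> Gam n" "\<gamma> \<in> Gam n" for k l \<xi> \<gamma>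
      unfolding Te[OF that(2)] Te[OF that(3)]
      by (rule off[OF _ q_mem[OF that(2)] q_mem[OF that(3)]]) (use that in simp)
    show "vinner ?H (T k (?e \<xi>)) (U (T k (?e \<gamma>))) = vinner ?H (T 0 (?e \<xi>)) (U (T 0 (?e \<gamma>)))"
      if "\<xi> \<in> Gam n" "\<gamma> \<in> Gam n" for k \<xi> \<gamma>
      unfolding Te[OF that(1)] Te[OF that(2)] by (rule diag[OF that])
  qed
  hence equiv: "unitarily_equivalent ?H U (model_space ?H (?e 0) ?W) (model_op ?H (?e 0) (restrict U ?W))"
    unfolding W by (rule repeated_block.unitarily_equivalent_model)
  have restricted: "op_matrix ?H ?e U (?q k \<xi>) (?q k \<gamma>) = op_matrix (subsp ?H ?W) ?e (restrict U ?W)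
      (real n / 2 + 2 * real n * \<xi>) (real n / 2 + 2 * real n * \<gamma>)"
    if "\<xi> \<in> Gam n" "\<gamma> \<in> Gam n" for k \<xi> \<gamma>
  proof -
    \<comment> \<open>\<open>restrict\<close> agrees with \<open>U\<close> only on W_0, so the basis
      vector of the column must be shown to lie there.\<close>
    have "?e (real n / 2 + 2 * real n * \<gamma>) \<in> ?W"
      using imageI[OF mem[of \<gamma>], of "T 0"] Te[OF that(2), of 0] by (simp add: W)
    thus ?thesis using diag[OF that, of k] by (simp add: op_matrix_def subsp_def)
  qed
  have matrix_corner: "op_matrix ?H ?e U 0 0 = 1"
    unfolding op_matrix_def by (rule corner)
  have matrix_off: "op_matrix ?H ?e U \<xi> \<gamma> = 0"
    if "i \<noteq> j" "\<xi> \<in> Gam_block n i" "\<gamma> \<in> Gam_block n j" for i j \<xi> \<gamma>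
    unfolding op_matrix_def by (rule off[OF that])
  show ?thesis
    using matrix_corner matrix_off restricted equiv by (intro conjI allI impI ballI)
qed

end
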